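(* As formal power series in $y_1,y_2$ with coefficients formal power series in $q$, the following identity holds: $$\prod_{m > 0} \frac{1}{(1-q^my_1)(1-q^my_2)(1-q^my_1y_2)(1-q^my_1y_2^2)(1-q^my_1y_2^3)(1-q^my_1^2y_2^3)}$$ $$= \sum_{\substack{r^{(1)}_{1}\geq r^{(2)}_{1}\geq r^{(3)}_{1} \geq \cdots \geq 0\\ r^{(1)}_{2}\geq r^{(2)}_{2} \geq r^{(3)}_{2}\geq \cdots \geq 0}} \frac{q^{\sum_{s\geq 1} (r^{(s)}_{1})^{2}+\sum_{s\geq 1} (r^{(s)}_{2})^{2}-\sum_{s\geq 1} r^{(s)}_{1}\left(r^{(3s)}_{2}+r^{(3s-1)}_{2}+r^{(3s-2)}_{2}\right)}}{(q)_{r^{(1)}_{1}-r^{(2)}_{1}}(q)_{r^{(2)}_{1}-r^{(3)}_{1}}\cdots\; (q)_{r^{(1)}_{2}-r^{(2)}_{2}}(q)_{r^{(2)}_{2}-r^{(3)}_{2}}\cdots }\;y_{1}^{r_1}y_{2}^{r_2},$$ where $r_1=\sum_{s\geq 1} r_1^{(s)}$, $r_2=\sum_{s\geq 1} r_2^{(s)}$, and the sum on the right-hand side is over all pairs of (weakly) descending infinite sequences $(r_1^{(s)})_{s\ge1}$, $(r_2^{(s)})_{s\ge1}$ of non-negative integers with finite support.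
   Context: Notation: $(q)_0=1$ and $(q)_r=(1-q)(1-q^2)\cdots(1-q^r)$ for $r>0$. Since the sequences have finite support, all but finitely many factors in each denominator equal $1$. *)

theory Defs
  imports "HOL-Analysis.Infinite_Sum" "HOL-Computational_Algebra.Formal_Power_Series"
begin

unbundle fps_syntax

text \<open>
  The ring of formal power series in \<open>y\<^sub>1, y\<^sub>2\<close> whose coefficients are formal power series in \<open>q\<close>
  over a field \<open>'a\<close> is \<open>'a fps fps fps\<close>: the outermost variable is \<open>y\<^sub>1\<close>, the middle one \<open>y\<^sub>2\<close>
  and the innermost one \<open>q\<close>. So \<open>F $ a $ b :: 'a fps\<close> is the coefficient of \<open>y\<^sub>1\<^sup>a y\<^sub>2\<^sup>b\<close> in \<open>F\<close>.
\<close>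

definition Y1 :: "'a::field fps fps fps" where
  "Y1 = fps_X"

definition Y2 :: "'a::field fps fps fps" where
  "Y2 = fps_const fps_X"

definition qconst :: "'a::field fps \<Rightarrow> 'a fps fps fps" where
  "qconst c = fps_const (fps_const c)"

abbreviation Q :: "'a::field fps fps fps" where
  "Q \<equiv> qconst fps_X"

text \<open>
  Infinite products and sums converge coefficientwise: for each monomial \<open>y\<^sub>1\<^sup>a y\<^sub>2\<^sup>b\<close>, the
  coefficients converge in the \<open>q\<close>-adic topology of \<open>'a fps\<close>. The library topology of
  \<open>'a fps fps fps\<close> itself is not usable here, since it treats the coefficients as discrete, and the
  coefficient of \<open>y\<^sub>1\<close> in the product is already an infinite series in \<open>q\<close>.
\<close>

definition has_formal_prod ::
    "(nat \<Rightarrow> 'a::field fps fps fps) \<Rightarrow> 'a fps fps fps \<Rightarrow> bool" where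
  "has_formal_prod f P \<longleftrightarrow>
     (\<forall>a b. (\<lambda>M. (\<Prod>m=1..M. f m) $ a $ b) \<longlonglongrightarrow> P $ a $ b)"

definition has_formal_sum ::
    "('i \<Rightarrow> 'a::field fps fps fps) \<Rightarrow> 'i set \<Rightarrow> 'a fps fps fps \<Rightarrow> bool" where
  "has_formal_sum f A S \<longleftrightarrow> (\<forall>a b. ((\<lambda>i. f i $ a $ b) has_sum (S $ a $ b)) A)"

definition product_factor :: "nat \<Rightarrow> 'a::field fps fps fps" where
  "product_factor m =
     inverse ((1 - Q ^ m * Y1) * (1 - Q ^ m * Y2) * (1 - Q ^ m * Y1 * Y2) *
              (1 - Q ^ m * Y1 * Y2 ^ 2) * (1 - Q ^ m * Y1 * Y2 ^ 3) *
              (1 - Q ^ m * Y1 ^ 2 * Y2 ^ 3))"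

definition qfact :: "nat \<Rightarrow> 'a::field fps" where
  "qfact r = (\<Prod>i=1..r. 1 - fps_X ^ i)"

text \<open>
  Sequences are indexed from \<open>0\<close>: \<open>r s\<close> stands for \<open>r\<^sup>(\<^sup>s\<^sup>+\<^sup>1\<^sup>)\<close>. With this shift, the entries
  \<open>3s-2, 3s-1, 3s\<close> (for \<open>s \<ge> 1\<close>) become \<open>3s, 3s+1, 3s+2\<close> (for \<open>s \<ge> 0\<close>).
\<close>

definition descending_seqs :: "(nat \<Rightarrow> nat) set" where
  "descending_seqs = {r. antimono r \<and> finite {s. r s \<noteq> 0}}"

definition total :: "(nat \<Rightarrow> nat) \<Rightarrow> nat" where
  "total r = (\<Sum>s | r s \<noteq> 0. r s)"

definition q_exponent :: "(nat \<Rightarrow> nat) \<Rightarrow> (nat \<Rightarrow> nat) \<Rightarrow> int" where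
  "q_exponent r1 r2 =
     (\<Sum>s | r1 s \<noteq> 0. int (r1 s) ^ 2) + (\<Sum>s | r2 s \<noteq> 0. int (r2 s) ^ 2)
     - (\<Sum>s | r1 s \<noteq> 0. int (r1 s) * (int (r2 (3*s+2)) + int (r2 (3*s+1)) + int (r2 (3*s))))"

text \<open>For \<open>r\<close> descending, the factors with \<open>r s = 0\<close> that are left out equal \<open>qfact 0 = 1\<close>.\<close>

definition q_denominator :: "(nat \<Rightarrow> nat) \<Rightarrow> 'a::field fps" where
  "q_denominator r = (\<Prod>s | r s \<noteq> 0. qfact (r s - r (Suc s)))"

text \<open>The exponent is never negative (see \<open>q_exponent_nonneg\<close> below), so \<^const>\<open>nat\<close> is harmless.\<close>

definition sum_term :: "(nat \<Rightarrow> nat) \<Rightarrow> (nat \<Rightarrow> nat) \<Rightarrow> 'a::field fps fps fps" where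
  "sum_term r1 r2 =
     qconst (fps_X ^ nat (q_exponent r1 r2) / (q_denominator r1 * q_denominator r2))
       * Y1 ^ total r1 * Y2 ^ total r2"

lemma q_exponent_nonneg:
  assumes "r1 \<in> descending_seqs" "r2 \<in> descending_seqs"
  shows "q_exponent r1 r2 \<ge> 0"
proof -
  have "finite ({s. r1 s \<noteq> 0} \<union> {s. r2 s \<noteq> 0})"
    using assms by (auto simp: descending_seqs_def)
  then obtain N where N: "\<And>s. r1 s \<noteq> 0 \<or> r2 s \<noteq> 0 \<Longrightarrow> s < N"
    unfolding finite_nat_set_iff_bounded by blast
  have N': "s < 3 * N" if "r2 s \<noteq> 0" for s
    using N [of s] that by simp
  have e1: "(\<Sum>s | r1 s \<noteq> 0. int (r1 s) ^ 2) = (\<Sum>s<N. int (r1 s) ^ 2)"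
    by (rule sum.mono_neutral_left) (use N in auto)
  have e2: "(\<Sum>s | r2 s \<noteq> 0. int (r2 s) ^ 2) = (\<Sum>s<3*N. int (r2 s) ^ 2)"
    by (rule sum.mono_neutral_left) (use N' in auto)
  have e3: "(\<Sum>s | r1 s \<noteq> 0. int (r1 s) * (int (r2 (3*s+2)) + int (r2 (3*s+1)) + int (r2 (3*s))))
      = (\<Sum>s<N. int (r1 s) * (int (r2 (3*s+2)) + int (r2 (3*s+1)) + int (r2 (3*s))))"
    by (rule sum.mono_neutral_left) (use N in auto)
  have e4: "(\<Sum>s<3*n. int (r2 s) ^ 2)
      = (\<Sum>s<n. int (r2 (3*s))^2 + int (r2 (3*s+1))^2 + int (r2 (3*s+2))^2)" for n
  proof (induction n)
    case (Suc n)
    have "3 * Suc n = Suc (Suc (Suc (3 * n)))" by simp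
    then show ?case by (simp only: sum.lessThan_Suc Suc) simp
  qed simp
  have sq: "x * (a + b + c) \<le> x^2 + (c^2 + b^2 + a^2)" for x a b c :: int
  proof -
    have "0 \<le> (x - 2*a)^2 + (x - 2*b)^2 + (x - 2*c)^2 + x^2"
      by simp
    also have "\<dots> = 4 * (x^2 + (c^2 + b^2 + a^2) - x * (a + b + c))"
      by (simp add: power2_eq_square algebra_simps)
    finally show ?thesis by simp
  qed
  show ?thesis
    unfolding q_exponent_def e1 e2 e3 e4 sum.distrib[symmetric] sum_subtractf[symmetric]
    by (rule sum_nonneg) (use sq in \<open>simp only: diff_ge_0_iff_ge\<close>)
qed

lemma has_formal_prod_unique:
  assumes "has_formal_prod f P" "has_formal_prod f P'"
  shows "P = P'"
proof (rule fps_ext, rule fps_ext)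
  show "P $ a $ b = P' $ a $ b" for a b
    using assms unfolding has_formal_prod_def by (meson LIMSEQ_unique)
qed

lemma has_formal_sum_unique:
  assumes "has_formal_sum f A S" "has_formal_sum f A S'"
  shows "S = S'"
proof (rule fps_ext, rule fps_ext)
  show "S $ a $ b = S' $ a $ b" for a b
    using assms unfolding has_formal_sum_def has_sum_def
    by (meson finite_subsets_at_top_neq_bot tendsto_unique)
qed

text \<open>The inverses taken above are genuine ones.\<close>

lemma fps_inverse_mult:
  fixes f :: "'a::{comm_ring_1, inverse} fps"
  assumes "inverse (f $ 0) * f $ 0 = 1"
  shows "inverse f * f = 1"
  using assms fps_left_inverse' [of "inverse (f $ 0)" f "inverse (f $ 0)"]
  by (simp add: fps_inverse_def mult.commute)

lemma product_factor_correct: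
  "product_factor m *
     ((1 - Q ^ m * Y1) * (1 - Q ^ m * Y2) * (1 - Q ^ m * Y1 * Y2) *
      (1 - Q ^ m * Y1 * Y2 ^ 2) * (1 - Q ^ m * Y1 * Y2 ^ 3) *
      (1 - Q ^ m * Y1 ^ 2 * Y2 ^ 3)) = (1 :: 'a::field fps fps fps)"
proof -
  let ?D = "(1 - Q ^ m * Y1) * (1 - Q ^ m * Y2) * (1 - Q ^ m * Y1 * Y2) *
      (1 - Q ^ m * Y1 * Y2 ^ 2) * (1 - Q ^ m * Y1 * Y2 ^ 3) *
      (1 - Q ^ m * Y1 ^ 2 * Y2 ^ 3) :: 'a fps fps fps"
  have Y: "(Y1 :: 'a fps fps fps) $ 0 = 0" and Z: "(Y2 :: 'a fps fps fps) $ 0 $ 0 = 0"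
    by (simp_all add: Y1_def Y2_def)
  have "(1 - Q ^ m * Y1 :: 'a fps fps fps) $ 0 $ 0 = 1"
    "(1 - Q ^ m * Y2 :: 'a fps fps fps) $ 0 $ 0 = 1"
    "(1 - Q ^ m * Y1 * Y2 :: 'a fps fps fps) $ 0 $ 0 = 1"
    "(1 - Q ^ m * Y1 * Y2 ^ 2 :: 'a fps fps fps) $ 0 $ 0 = 1"
    "(1 - Q ^ m * Y1 * Y2 ^ 3 :: 'a fps fps fps) $ 0 $ 0 = 1"
    "(1 - Q ^ m * Y1 ^ 2 * Y2 ^ 3 :: 'a fps fps fps) $ 0 $ 0 = 1"
    by (simp_all add: Y Z fps_nth_power_0)
  then have D0: "?D $ 0 $ 0 = 1"
    by (simp only: fps_mult_nth_0 mult_1_left)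
  have "inverse (?D $ 0 $ 0) * ?D $ 0 $ 0 = 1"
    unfolding D0 by simp
  then show ?thesis
    unfolding product_factor_def by (rule fps_inverse_mult [OF fps_inverse_mult])
qed

lemma q_denominator_nonzero: "q_denominator r $ 0 \<noteq> (0 :: 'a::field)"
proof -
  have prod0: "(\<Prod>i\<in>A. f i) $ 0 = (\<Prod>i\<in>A. f i $ 0)" for A :: "nat set" and f :: "nat \<Rightarrow> 'a fps"
    by (induction A rule: infinite_finite_induct) auto
  have "qfact n $ 0 = (1 :: 'a)" for n
    unfolding qfact_def prod0 by (rule prod.neutral) auto
  then show ?thesis
    unfolding q_denominator_def prod0 by simp
qed

end

theory Submission
  imports Defs "HOL-Library.Product_Plus" "HOL-Computational_Algebra.Formal_Laurent_Series"
begin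

text \<open>
  Write the \<open>y\<^sub>1\<^sup>a y\<^sub>2\<^sup>b\<close>-coefficient of the sum over a field in which \<open>q\<close> is invertible. For a fixed
  sequence \<open>r1\<close> the sum over \<open>r2\<close> is a series \<open>Z\<^sub>n(y\<^sub>2)\<close>, where \<open>n\<close> lists the numbers that are paired
  with the entries of \<open>r2\<close>, and likewise with the roles exchanged. The key point is that
  \<open>P\<^sub>n(y) = Z\<^sub>n(y) \<Prod>\<^sub>m (1 - q\<^sup>m y)\<close> is a palindromic polynomial of degree \<open>\<Sum>\<^sub>s n\<^sub>s\<close>. (With \<open>q\<close> replaced by
  \<open>1 / q\<close> it counts the subgroups of a finite abelian \<open>p\<close>-group, and the symmetry is the duality of
  these groups.) It is proved by induction from
  \<open>(1 - y) P\<^sub>n\<^sub>'(y) = P\<^sub>n(y / q) - y\<^sup>M\<^sup>+\<^sup>1 q\<^sup>-\<^sup>|\<^sup>n\<^sup>| P\<^sub>n(q y)\<close>, where \<open>n'\<close> is \<open>n\<close> with its first \<open>M\<close> entries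
  raised by one and the other entries of \<open>n\<close> are zero.

  Hence the sum, divided by \<open>\<Prod>\<^sub>m 1 / (1 - q\<^sup>m y\<^sub>i)\<close>, is invariant under the simple reflection \<open>s\<^sub>i\<close> of \<open>G\<^sub>2\<close>
  acting on exponents, for \<open>i = 1, 2\<close>. The product over the positive roots has the same two
  properties, because \<open>s\<^sub>i\<close> permutes the positive roots other than the \<open>i\<close>-th simple one. At a monomial
  of least total degree in the difference of the two sides, the reflections force the exponent to
  be zero, and there both sides are 1.
\<close>

section \<open>Descending sequences of given total\<close>

definition desc_of :: "nat \<Rightarrow> (nat \<Rightarrow> nat) set" where
  "desc_of b = {r \<in> descending_seqs. total r = b}"

lemma sum_support_lessThan:
  fixes r :: "nat \<Rightarrow> nat"
  assumes "\<And>s. N \<le> s \<Longrightarrow> r s = 0" "\<And>s. r s = 0 \<Longrightarrow> f s = 0"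
  shows "(\<Sum>s | r s \<noteq> 0. f s) = (\<Sum>s<N. f s)"
proof (rule sum.mono_neutral_left)
  show "{s. r s \<noteq> 0} \<subseteq> {..<N}"
    by (metis (mono_tags) assms(1) lessThan_iff mem_Collect_eq not_less subsetI)
qed (use assms(2) in auto)

lemma prod_support_lessThan:
  fixes r :: "nat \<Rightarrow> nat"
  assumes "\<And>s. N \<le> s \<Longrightarrow> r s = 0" "\<And>s. r s = 0 \<Longrightarrow> f s = 1"
  shows "(\<Prod>s | r s \<noteq> 0. f s) = (\<Prod>s<N. f s)"
proof (rule prod.mono_neutral_left)
  show "{s. r s \<noteq> 0} \<subseteq> {..<N}"
    by (metis (mono_tags) assms(1) lessThan_iff mem_Collect_eq not_less subsetI)
qed (use assms(2) in auto)

lemma descending_seqs_iff: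
  "r \<in> descending_seqs \<longleftrightarrow> antimono r \<and> (\<exists>N. \<forall>s\<ge>N. r s = 0)"
proof -
  have "finite {s. r s \<noteq> 0} \<longleftrightarrow> (\<exists>N. \<forall>s\<ge>N. r s = 0)"
  proof
    assume "finite {s. r s \<noteq> 0}"
    then obtain N where "\<And>s. r s \<noteq> 0 \<Longrightarrow> s < N"
      unfolding finite_nat_set_iff_bounded by blast
    then show "\<exists>N. \<forall>s\<ge>N. r s = 0"
      by (meson leD)
  next
    assume "\<exists>N. \<forall>s\<ge>N. r s = 0"
    then obtain N where "\<forall>s\<ge>N. r s = 0" by blast
    then have "{s. r s \<noteq> 0} \<subseteq> {..<N}"
      by (auto simp: not_less[symmetric])
    then show "finite {s. r s \<noteq> 0}"
      using finite_subset by blast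
  qed
  then show ?thesis by (simp add: descending_seqs_def)
qed

lemma total_lessThan:
  assumes "\<And>s. N \<le> s \<Longrightarrow> r s = 0"
  shows "total r = (\<Sum>s<N. r s)"
  unfolding total_def by (rule sum_support_lessThan) (use assms in auto)

text \<open>If \<open>r s\<close> is nonzero, the s + 1 entries up to it are all at least 1, so the
  total exceeds s. This bounds the supports of all sequences of total b at once.\<close>

lemma desc_of_eq_0:
  assumes "r \<in> desc_of b" "b \<le> s"
  shows "r s = 0"
proof (rule ccontr)
  assume ne: "r s \<noteq> 0"
  obtain N where N: "\<And>s. N \<le> s \<Longrightarrow> r s = 0"
    using assms by (auto simp: desc_of_def descending_seqs_iff)
  have anti: "antimono r"
    using assms by (simp add: desc_of_def descending_seqs_def)
  have "s < N" using N ne by (meson not_less)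
  have "Suc s = (\<Sum>i<Suc s. 1)" by simp
  also have "\<dots> \<le> (\<Sum>i<Suc s. r i)"
  proof (rule sum_mono)
    fix i assume "i \<in> {..<Suc s}"
    then have "r s \<le> r i" using anti by (auto simp: antimono_def)
    then show "1 \<le> r i" using ne by linarith
  qed
  also have "\<dots> \<le> (\<Sum>i<N. r i)"
    by (rule sum_mono2) (use \<open>s < N\<close> in auto)
  also have "\<dots> = b"
    using assms(1) total_lessThan[OF N] by (simp add: desc_of_def)
  finally show False using assms(2) by simp
qed

lemma total_desc_of: "r \<in> desc_of b \<Longrightarrow> total r = b"
  by (simp add: desc_of_def)

lemma desc_of_le:
  assumes "r \<in> desc_of b"
  shows "r s \<le> b"
proof (cases "s < b")
  case True
  have "r s \<le> (\<Sum>i<b. r i)"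
    by (rule member_le_sum) (use True in auto)
  also have "\<dots> = b"
    using total_lessThan[of b r] desc_of_eq_0[OF assms] total_desc_of[OF assms] by simp
  finally show ?thesis .
qed (use desc_of_eq_0[OF assms] in simp)

lemma finite_desc_of: "finite (desc_of b)"
proof (rule finite_subset)
  show "desc_of b \<subseteq> {r. \<forall>s. (s \<in> {..<b} \<longrightarrow> r s \<in> {..b}) \<and> (s \<notin> {..<b} \<longrightarrow> r s = 0)}"
    using desc_of_le desc_of_eq_0 by (auto simp: not_less)
  show "finite {r. \<forall>s. (s \<in> {..<b} \<longrightarrow> r s \<in> {..b}) \<and> (s \<notin> {..<b} \<longrightarrow> r s = (0::nat))}"
    by (rule finite_set_of_finite_funs) auto
qed

lemma desc_of_0: "desc_of 0 = {\<lambda>_. 0}"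
proof -
  have "r = (\<lambda>_. 0)" if "r \<in> desc_of 0" for r
    using desc_of_eq_0[OF that] by auto
  moreover have "(\<lambda>_. 0) \<in> desc_of 0"
    by (simp add: desc_of_def descending_seqs_iff total_def antimono_def)
  ultimately show ?thesis by blast
qed

lemma case_nat_desc_of_iff:
  "case_nat j r \<in> desc_of (j + c) \<longleftrightarrow> r \<in> desc_of c \<and> r 0 \<le> j"
proof -
  have anti: "antimono (case_nat j r) \<longleftrightarrow> antimono r \<and> r 0 \<le> j"
    by (auto simp: antimono_iff_le_Suc split: nat.split)
  have supp: "(\<exists>N. \<forall>s\<ge>N. case_nat j r s = 0) \<longleftrightarrow> (\<exists>N. \<forall>s\<ge>N. r s = 0)"
  proof
    assume "\<exists>N. \<forall>s\<ge>N. case_nat j r s = 0"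
    then obtain N where N: "\<And>s. s \<ge> N \<Longrightarrow> case_nat j r s = 0" by blast
    have "r s = 0" if "s \<ge> N" for s using N[of "Suc s"] that by simp
    then show "\<exists>N. \<forall>s\<ge>N. r s = 0" by blast
  next
    assume "\<exists>N. \<forall>s\<ge>N. r s = 0"
    then obtain N where N: "\<And>s. s \<ge> N \<Longrightarrow> r s = 0" by blast
    have "case_nat j r s = 0" if "s \<ge> Suc N" for s using N[of "s - 1"] that by (cases s) auto
    then show "\<exists>N. \<forall>s\<ge>N. case_nat j r s = 0" by blast
  qed
  have tot: "total (case_nat j r) = j + total r" if "\<exists>N. \<forall>s\<ge>N. r s = 0"
  proof -
    from that obtain N where N: "\<And>s. s \<ge> N \<Longrightarrow> r s = 0" by blast
    have N': "case_nat j r s = 0" if "s \<ge> Suc N" for s using N[of "s - 1"] that by (cases s) auto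
    show ?thesis
      using total_lessThan[of N r] N total_lessThan[of "Suc N" "case_nat j r"] N'
      by (simp add: sum.lessThan_Suc_shift del: sum.lessThan_Suc)
  qed
  show ?thesis
    unfolding desc_of_def descending_seqs_iff mem_Collect_eq anti supp using tot
    by (metis (no_types, lifting) add_left_cancel)
qed

text \<open>Recursion on the largest entry j: the rest is again descending, has total b - j and
  starts at most at j.\<close>

lemma sum_desc_of_peel:
  "(\<Sum>r\<in>desc_of b. f r) = (\<Sum>j\<le>b. \<Sum>r | r \<in> desc_of (b - j) \<and> r 0 \<le> j. f (case_nat j r))"
proof -
  have fin: "finite {r. r \<in> desc_of (b - j) \<and> r 0 \<le> j}" for j
    using finite_desc_of[of "b - j"] by simp
  have "(\<Sum>j\<le>b. \<Sum>r | r \<in> desc_of (b - j) \<and> r 0 \<le> j. f (case_nat j r))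
      = (\<Sum>(j, r)\<in>(SIGMA j:{..b}. {r. r \<in> desc_of (b - j) \<and> r 0 \<le> j}). f (case_nat j r))"
    by (rule sum.Sigma) (use fin in auto)
  also have "\<dots> = (\<Sum>r\<in>desc_of b. f r)"
  proof (rule sum.reindex_bij_witness[where i = "\<lambda>r. (r 0, \<lambda>s. r (Suc s))"
        and j = "\<lambda>(j, r). case_nat j r"])
    fix r assume r: "r \<in> desc_of b"
    have eq: "case_nat (r 0) (\<lambda>s. r (Suc s)) = r"
      by (rule ext) (simp split: nat.split)
    then show "(\<lambda>(j, r). case_nat j r) (r 0, \<lambda>s. r (Suc s)) = r" by simp
    have "r 0 \<le> b" using desc_of_le[OF r] .
    then show "(r 0, \<lambda>s. r (Suc s)) \<in> (SIGMA j:{..b}. {r. r \<in> desc_of (b - j) \<and> r 0 \<le> j})"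
      using case_nat_desc_of_iff[of "r 0" "\<lambda>s. r (Suc s)" "b - r 0"] r eq by simp
  next
    fix a assume "a \<in> (SIGMA j:{..b}. {r. r \<in> desc_of (b - j) \<and> r 0 \<le> j})"
    then show "(case a of (j, r) \<Rightarrow> case_nat j r) \<in> desc_of b"
      using case_nat_desc_of_iff[of "fst a" "snd a" "b - fst a"] by (auto split: prod.splits)
  qed (auto split: prod.splits)
  finally show ?thesis ..
qed

section \<open>The series of weighted descending sequences\<close>

text \<open>The weights contain negative powers of q and divisions by 1 - q^n; these hypotheses make
  both legitimate. The instance is q = \<open>fls_X\<close> in the field of Laurent series.\<close>

locale q_series =
  fixes q :: "'k::field"
  assumes q_nonzero: "q \<noteq> 0" and q_power_neq_1: "0 < n \<Longrightarrow> q ^ n \<noteq> 1"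
begin

definition qp :: "nat \<Rightarrow> 'k" where
  "qp n = (\<Prod>i=1..n. 1 - q ^ i)"

lemma qp_0 [simp]: "qp 0 = 1"
  by (simp add: qp_def)

lemma qp_Suc: "qp (Suc n) = qp n * (1 - q ^ Suc n)"
  by (simp add: qp_def)

lemma one_minus_q_power_nonzero [simp]: "1 - q ^ Suc n \<noteq> 0"
  using q_power_neq_1[of "Suc n"] by (simp del: power_Suc)

lemma qp_nonzero [simp]: "qp n \<noteq> 0"
  by (induction n) (use one_minus_q_power_nonzero in \<open>simp_all only: qp_0 qp_Suc mult_eq_0_iff one_neq_zero simp_thms\<close>)

definition weight :: "(nat \<Rightarrow> nat) \<Rightarrow> (nat \<Rightarrow> nat) \<Rightarrow> 'k" where
  "weight n r = q ^ (\<Sum>s | r s \<noteq> 0. (r s)\<^sup>2) / q ^ (\<Sum>s | r s \<noteq> 0. r s * n s)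
     / (\<Prod>s | r s \<noteq> 0. qp (r s - r (Suc s)))"

lemma weight_lessThan:
  assumes "\<And>s. N \<le> s \<Longrightarrow> r s = 0"
  shows "weight n r = q ^ (\<Sum>s<N. (r s)\<^sup>2) / q ^ (\<Sum>s<N. r s * n s)
     / (\<Prod>s<N. qp (r s - r (Suc s)))"
proof -
  have "(\<Sum>s | r s \<noteq> 0. (r s)\<^sup>2) = (\<Sum>s<N. (r s)\<^sup>2)"
    "(\<Sum>s | r s \<noteq> 0. r s * n s) = (\<Sum>s<N. r s * n s)"
    by (rule sum_support_lessThan; use assms in simp)+
  moreover have "(\<Prod>s | r s \<noteq> 0. qp (r s - r (Suc s))) = (\<Prod>s<N. qp (r s - r (Suc s)))"
    by (rule prod_support_lessThan) (use assms in auto)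
  ultimately show ?thesis by (simp add: weight_def)
qed

lemma weight_0 [simp]: "weight n (\<lambda>_. 0) = 1"
  by (simp add: weight_def)

lemma weight_case_nat:
  assumes "r \<in> desc_of c"
  shows "weight n (case_nat j r)
      = q ^ j\<^sup>2 / q ^ (j * n 0) / qp (j - r 0) * weight (\<lambda>s. n (Suc s)) r"
proof -
  have N: "r s = 0" if "c \<le> s" for s
    using desc_of_eq_0[OF assms that] .
  have N': "case_nat j r s = 0" if "Suc c \<le> s" for s
    using N[of "s - 1"] that by (cases s) auto
  show ?thesis
    using weight_lessThan[of c r] N weight_lessThan[of "Suc c" "case_nat j r" n] N'
    by (simp add: sum.lessThan_Suc_shift prod.lessThan_Suc_shift power_add
        del: sum.lessThan_Suc prod.lessThan_Suc)
qed

text \<open>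
  The parameter \<open>u\<close> carries the factor that depends on the entry preceding \<open>r 0\<close>: it is constantly 1
  at the top level, and \<open>bounded k\<close> once a first entry \<open>k\<close> has been split off.
\<close>

definition Zs :: "(nat \<Rightarrow> 'k) \<Rightarrow> (nat \<Rightarrow> nat) \<Rightarrow> 'k fps" where
  "Zs u n = Abs_fps (\<lambda>b. \<Sum>r\<in>desc_of b. u (r 0) * weight n r)"

text \<open>The denominator factor linking an entry k to its successor j. The value 0 for j > k
  encodes descent, so the remaining sum can run over all of \<open>desc_of\<close>.\<close>

definition bounded :: "nat \<Rightarrow> nat \<Rightarrow> 'k" where
  "bounded k j = (if j \<le> k then 1 / qp (k - j) else 0)"

lemma Zs_nth_0 [simp]: "Zs u n $ 0 = u 0"
  by (simp add: Zs_def desc_of_0)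

lemma Zs_peel:
  "Zs u n $ b = (\<Sum>j\<le>b. u j * q ^ j\<^sup>2 / q ^ (j * n 0) * Zs (bounded j) (\<lambda>s. n (Suc s)) $ (b - j))"
proof -
  have "(\<Sum>r | r \<in> desc_of (b - j) \<and> r 0 \<le> j. u (case_nat j r 0) * weight n (case_nat j r))
      = u j * q ^ j\<^sup>2 / q ^ (j * n 0) * Zs (bounded j) (\<lambda>s. n (Suc s)) $ (b - j)" for j
  proof -
    have "(\<Sum>r | r \<in> desc_of (b - j) \<and> r 0 \<le> j. u (case_nat j r 0) * weight n (case_nat j r))
      = (\<Sum>r\<in>desc_of (b - j). if r 0 \<le> j then u j * weight n (case_nat j r) else 0)"
      using finite_desc_of by (simp add: sum.If_cases Int_def conj_commute)
    also have "\<dots> = (\<Sum>r\<in>desc_of (b - j). u j * q ^ j\<^sup>2 / q ^ (j * n 0) *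
        (bounded j (r 0) * weight (\<lambda>s. n (Suc s)) r))"
      by (rule sum.cong) (auto simp: weight_case_nat bounded_def field_simps)
    finally show ?thesis by (simp add: Zs_def sum_distrib_left)
  qed
  then show ?thesis
    unfolding Zs_def[of u n] fps_nth_Abs_fps sum_desc_of_peel[of _ b] by simp
qed

end

section \<open>Dilations y -> c y and locally finite combinations of power series\<close>

definition dil :: "'k::field \<Rightarrow> 'k fps \<Rightarrow> 'k fps" where
  "dil c F = Abs_fps (\<lambda>n. c ^ n * F $ n)"

lemma dil_nth [simp]: "dil c F $ n = c ^ n * F $ n"
  by (simp add: dil_def)

lemma dil_mult: "dil c (F * G) = dil c F * dil c G"
proof (rule fps_ext)
  fix n
  have "c ^ n * (\<Sum>i=0..n. F $ i * G $ (n - i)) = (\<Sum>i=0..n. (c ^ i * F $ i) * (c ^ (n - i) * G $ (n - i)))"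
    unfolding sum_distrib_left by (rule sum.cong) (auto simp: power_add [symmetric] mult_ac)
  then show "dil c (F * G) $ n = (dil c F * dil c G) $ n"
    by (simp add: fps_mult_nth)
qed

lemma dil_diff: "dil c (F - G) = dil c F - dil c G"
  by (rule fps_ext) (simp add: algebra_simps)

lemma dil_const [simp]: "dil c (fps_const a) = fps_const a"
  by (rule fps_ext) simp

lemma dil_1 [simp]: "dil c 1 = 1"
  by (rule fps_ext) simp

lemma dil_X [simp]: "dil c fps_X = fps_const c * fps_X"
  by (rule fps_ext) (simp add: fps_X_def)

lemma dil_inverse:
  assumes "F $ 0 \<noteq> 0"
  shows "dil c (inverse F) = inverse (dil c F)"
proof -
  have "dil c (inverse F) * dil c F = 1"
    unfolding dil_mult [symmetric] using assms by (simp add: inverse_mult_eq_1)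
  then show ?thesis
    by (metis fps_inverse_unique mult.commute)
qed

text \<open>\<^term>\<open>comb c G\<close> is the series \<open>\<Sum>j. c j * y ^ j * G j\<close>.\<close>

definition comb :: "(nat \<Rightarrow> 'k::field) \<Rightarrow> (nat \<Rightarrow> 'k fps) \<Rightarrow> 'k fps" where
  "comb c G = Abs_fps (\<lambda>b. \<Sum>j\<le>b. c j * G j $ (b - j))"

text \<open>Terms with j > b do not reach degree b, so distributivity is inherited from finite
  sums.\<close>

lemma comb_nth_eq_sum:
  assumes "b \<le> N"
  shows "comb c G $ b = (\<Sum>j\<le>N. fps_const (c j) * (fps_X ^ j * G j)) $ b"
proof -
  have "(\<Sum>j\<le>N. fps_const (c j) * (fps_X ^ j * G j)) $ b
      = (\<Sum>j\<le>N. if j \<le> b then c j * G j $ (b - j) else 0)"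
    by (auto simp: fps_sum_nth fps_X_power_mult_nth intro!: sum.cong)
  also have "\<dots> = (\<Sum>j\<le>b. c j * G j $ (b - j))"
    by (rule sum.mono_neutral_cong_right) (use assms in auto)
  finally show ?thesis by (simp add: comb_def)
qed

lemma mult_comb: "A * comb c G = comb c (\<lambda>j. A * G j)"
proof (rule fps_ext)
  fix b
  have "(A * comb c G) $ b = (A * (\<Sum>j\<le>b. fps_const (c j) * (fps_X ^ j * G j))) $ b"
    unfolding fps_mult_nth by (intro sum.cong refl arg_cong2[where f = "(*)"] comb_nth_eq_sum) auto
  also have "\<dots> = (\<Sum>j\<le>b. fps_const (c j) * (fps_X ^ j * (A * G j))) $ b"
    by (simp add: sum_distrib_left mult_ac)
  finally show "(A * comb c G) $ b = comb c (\<lambda>j. A * G j) $ b"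
    by (simp add: comb_nth_eq_sum[of b b])
qed

lemma comb_diff: "comb c G - comb c G' = comb c (\<lambda>j. G j - G' j)"
  by (rule fps_ext) (simp add: comb_def sum_subtractf algebra_simps)

lemma comb_add: "comb c G + comb c G' = comb c (\<lambda>j. G j + G' j)"
  by (rule fps_ext) (simp add: comb_def sum.distrib algebra_simps)

lemma comb_add_coeff: "comb c G + comb d G = comb (\<lambda>j. c j + d j) G"
  by (rule fps_ext) (simp add: comb_def sum.distrib algebra_simps)

lemma comb_diff_coeff: "comb c G - comb d G = comb (\<lambda>j. c j - d j) G"
  by (rule fps_ext) (simp add: comb_def sum_subtractf algebra_simps)

lemma comb_const: "comb c (\<lambda>j. fps_const (d j) * G j) = comb (\<lambda>j. c j * d j) G"
  by (rule fps_ext) (simp add: comb_def mult.assoc)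

lemma const_mult_comb: "fps_const a * comb c G = comb (\<lambda>j. a * c j) G"
  by (rule fps_ext) (simp add: comb_def sum_distrib_left mult.assoc)

lemma comb_cong: "(\<And>j. c j = d j) \<Longrightarrow> (\<And>j. G j = H j) \<Longrightarrow> comb c G = comb d H"
  by presburger

lemma dil_comb: "dil x (comb c G) = comb (\<lambda>j. c j * x ^ j) (\<lambda>j. dil x (G j))"
proof (rule fps_ext)
  fix b
  show "dil x (comb c G) $ b = comb (\<lambda>j. c j * x ^ j) (\<lambda>j. dil x (G j)) $ b"
    unfolding comb_def dil_nth fps_nth_Abs_fps sum_distrib_left
    by (rule sum.cong) (auto simp: power_add [symmetric] mult_ac)
qed

text \<open>The hypothesis is put on the product because sometimes \<open>c 0\<close> and sometimes
  \<open>G 0\<close> vanishes.\<close>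

lemma comb_Suc:
  assumes "fps_const (c 0) * G 0 = 0"
  shows "comb c G = fps_X * comb (\<lambda>j. c (Suc j)) (\<lambda>j. G (Suc j))"
proof (rule fps_ext)
  fix b
  have 0: "c 0 * G 0 $ i = 0" for i
    using arg_cong[OF assms, of "\<lambda>F. F $ i"] by simp
  show "comb c G $ b = (fps_X * comb (\<lambda>j. c (Suc j)) (\<lambda>j. G (Suc j))) $ b"
  proof (cases b)
    case (Suc b')
    have "(\<Sum>j\<le>Suc b'. c j * G j $ (Suc b' - j)) = (\<Sum>j\<le>b'. c (Suc j) * G (Suc j) $ (b' - j))"
      by (subst sum.atMost_Suc_shift) (simp add: 0)
    then show ?thesis by (simp add: comb_def Suc)
  qed (simp add: comb_def 0)
qed

section \<open>Closed form for sequences paired with zero\<close>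

context q_series
begin

abbreviation "lin \<equiv> 1 - fps_const q * fps_X"

definition yp :: "nat \<Rightarrow> 'k fps" where
  "yp k = (\<Prod>i=1..k. 1 - fps_const (q ^ i) * fps_X)"

lemma yp_Suc: "yp (Suc k) = yp k * (1 - fps_const (q ^ Suc k) * fps_X)"
  by (simp add: yp_def)

lemma yp_Suc': "yp (Suc k) = lin * dil q (yp k)"
proof (induction k)
  case 0
  then show ?case by (simp add: yp_def)
next
  case (Suc k)
  have "yp (Suc (Suc k)) = lin * dil q (yp k) * (1 - fps_const (q ^ Suc (Suc k)) * fps_X)"
    by (subst yp_Suc) (simp only: Suc)
  also have "\<dots> = lin * dil q (yp (Suc k))"
    by (simp add: yp_Suc dil_mult dil_diff mult_ac)
  finally show ?case .
qed

lemma yp_nth_0 [simp]: "yp k $ 0 = 1"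
  by (induction k) (simp_all add: yp_Suc, simp add: yp_def)

text \<open>\<^term>\<open>tail k\<close> is \<open>1 / ((q)\<^sub>k (1 - q y) \<cdots> (1 - q\<^sup>k y))\<close>, the sum over the entries paired with zero.\<close>

definition tail :: "nat \<Rightarrow> 'k fps" where
  "tail k = fps_const (1 / qp k) * inverse (yp k)"

lemma yp_inverse: "yp k * inverse (yp k) = 1"
  by (simp add: inverse_mult_eq_1')

lemma dil_tail: "dil q (tail k) = fps_const (1 / qp k) * inverse (dil q (yp k))"
  by (simp add: tail_def dil_mult dil_inverse)

lemma lin_tail_Suc: "lin * (fps_const (1 - q ^ Suc k) * tail (Suc k)) = dil q (tail k)"
proof -
  have "inverse (yp (Suc k)) = inverse lin * inverse (dil q (yp k))"
    by (simp only: yp_Suc' Formal_Power_Series.fps_inverse_mult)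
  moreover have "lin * inverse lin = 1"
    by (simp add: inverse_mult_eq_1')
  moreover have "fps_const (1 - q ^ Suc k) * fps_const (1 / qp (Suc k)) = fps_const (1 / qp k)"
    using one_minus_q_power_nonzero[of k] by (simp add: qp_Suc del: power_Suc)
  ultimately have "(lin * inverse lin) * ((fps_const (1 - q ^ Suc k) * fps_const (1 / qp (Suc k)))
      * inverse (dil q (yp k))) = dil q (tail k)" "tail (Suc k) = fps_const (1 / qp (Suc k)) *
      (inverse lin * inverse (dil q (yp k)))"
    by (simp_all only: mult_1 dil_tail, simp only: tail_def)
  then show ?thesis
    by (simp only: mult_ac)
qed

text \<open>The denominators on the two sides run over the factors 2..k+1 and 1..k, so they differ
  only at the ends. The proof splits \<open>yp (Suc k)\<close> at either end.\<close>

lemma dil_tail_shift: "dil q (tail k) * (1 - fps_const (q ^ Suc k) * fps_X) = lin * tail k"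
proof -
  have nz: "dil q (yp k) $ 0 \<noteq> 0" "yp k $ 0 \<noteq> 0" by simp_all
  have "dil q (yp k) * (dil q (tail k) * (1 - fps_const (q ^ Suc k) * fps_X) * yp k)
      = dil q (yp k) * (lin * tail k * yp k)"
  proof -
    have "dil q (yp k) * (dil q (tail k) * (1 - fps_const (q ^ Suc k) * fps_X) * yp k)
        = (dil q (yp k) * inverse (dil q (yp k))) * fps_const (1 / qp k) * yp (Suc k)"
      by (simp only: yp_Suc dil_tail mult_ac)
    also have "\<dots> = fps_const (1 / qp k) * (lin * dil q (yp k))"
      using inverse_mult_eq_1'[OF nz(1)] by (simp only: yp_Suc' mult_1)
    also have "\<dots> = fps_const (1 / qp k) * (lin * dil q (yp k)) * (yp k * inverse (yp k))"
      by (simp only: yp_inverse mult_1_right)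
    also have "\<dots> = dil q (yp k) * (lin * tail k * yp k)"
      by (simp only: tail_def mult_ac)
    finally show ?thesis .
  qed
  moreover have "dil q (yp k) \<noteq> 0" "yp k \<noteq> 0"
    using nz by (metis fps_zero_nth)+
  ultimately show ?thesis
    by (metis mult_left_cancel mult_right_cancel)
qed

lemma bounded_Suc_Suc: "bounded (Suc k) (Suc j) = bounded k j"
  by (simp add: bounded_def)

lemma bounded_0_Suc: "bounded 0 (Suc j) = 0"
  by (simp add: bounded_def)

text \<open>A Pascal-type rule: split 1 - q^(k+1) = q^j (1 - q^(k+1-j)) + (1 - q^j), where the
  bracket after q^j cancels the last factor of (q)_(k+1-j).\<close>

lemma bounded_Suc:
  "(1 - q ^ Suc k) * bounded (Suc k) j = q ^ j * bounded k j + (1 - q ^ j) * bounded (Suc k) j"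
proof -
  consider "j \<le> k" | "j = Suc k" | "j > Suc k" by linarith
  then show ?thesis
  proof cases
    case 1
    have "q ^ Suc k = q ^ j * q ^ (Suc (k - j))"
      using 1 by (simp add: power_add [symmetric] Suc_diff_le)
    moreover have "qp (Suc k - j) = qp (k - j) * (1 - q ^ Suc (k - j))"
      using 1 by (simp add: Suc_diff_le qp_Suc)
    moreover have "1 - q ^ Suc (k - j) \<noteq> 0" by (rule one_minus_q_power_nonzero)
    ultimately show ?thesis
      using 1 by (simp add: bounded_def divide_simps del: power_Suc) (simp add: algebra_simps)
  qed (simp_all add: bounded_def)
qed

text \<open>The Durfee square identity 1/(yq)_k = sum_j [k choose j] q^(j^2) y^j / (yq)_j, divided
  by (q)_k. The induction multiplies case k + 1 by (1 - q^(k+1)) (1 - q y) and recovers case k at q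
  y.\<close>

lemma tail_recursion: "tail k = comb (\<lambda>j. bounded k j * q ^ j\<^sup>2) tail"
proof (induction k)
  case 0
  have "comb (\<lambda>j. bounded 0 j * q ^ j\<^sup>2) tail $ b = tail 0 $ b" for b
  proof -
    have "(\<Sum>j\<le>b. bounded 0 j * q ^ j\<^sup>2 * tail j $ (b - j)) = (\<Sum>j\<in>{0::nat}. tail 0 $ b)"
      by (rule sum.mono_neutral_cong_right) (auto simp: bounded_def)
    then show ?thesis by (simp add: comb_def)
  qed
  then show ?case by (metis fps_ext)
next
  case (Suc k)
  define S where "S = comb (\<lambda>j. bounded (Suc k) j * q ^ j\<^sup>2) tail"
  have "fps_const (1 - q ^ Suc k) * S
      = comb (\<lambda>j. bounded k j * q ^ (j\<^sup>2 + j)) tail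
        + comb (\<lambda>j. bounded (Suc k) j * q ^ j\<^sup>2 * (1 - q ^ j)) tail"
    unfolding S_def const_mult_comb comb_add_coeff
  proof (rule comb_cong)
    fix j
    show "(1 - q ^ Suc k) * (bounded (Suc k) j * q ^ j\<^sup>2)
        = bounded k j * q ^ (j\<^sup>2 + j) + bounded (Suc k) j * q ^ j\<^sup>2 * (1 - q ^ j)"
      using arg_cong[OF bounded_Suc[of k j], of "\<lambda>x. x * q ^ j\<^sup>2"]
      by (simp only: power_add distrib_left distrib_right mult_ac)
  qed simp
  \<comment> \<open>The factor 1 - q^j kills the term j = 0, and shifting j turns
    \<open>bounded (Suc k)\<close> into \<open>bounded k\<close>.\<close>
  also have "comb (\<lambda>j. bounded (Suc k) j * q ^ j\<^sup>2 * (1 - q ^ j)) tail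
      = fps_X * comb (\<lambda>j. bounded k j * q ^ (Suc j)\<^sup>2 * (1 - q ^ Suc j)) (\<lambda>j. tail (Suc j))"
    by (subst comb_Suc) (simp_all only: bounded_Suc_Suc, simp)
  also have "\<dots> = fps_X * comb (\<lambda>j. bounded k j * q ^ (Suc j)\<^sup>2)
      (\<lambda>j. fps_const (1 - q ^ Suc j) * tail (Suc j))"
    unfolding comb_const ..
  finally have "lin * (fps_const (1 - q ^ Suc k) * S) =
      comb (\<lambda>j. bounded k j * q ^ (j\<^sup>2 + j)) (\<lambda>j. lin * tail j)
      + fps_X * comb (\<lambda>j. bounded k j * q ^ (Suc j)\<^sup>2) (\<lambda>j. dil q (tail j))"
    by (simp only: distrib_left mult_comb lin_tail_Suc mult.left_commute[of lin fps_X])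
  also have "fps_X * comb (\<lambda>j. bounded k j * q ^ (Suc j)\<^sup>2) (\<lambda>j. dil q (tail j))
      = comb (\<lambda>j. bounded k j * q ^ (j\<^sup>2 + j)) (\<lambda>j. fps_const (q ^ Suc j) * (fps_X * dil q (tail j)))"
    unfolding comb_const mult_comb
    by (rule comb_cong) (simp_all add: power2_eq_square power_add)
  \<comment> \<open>The two sums now have equal coefficients and merge through
    \<open>dil_tail_shift\<close>.\<close>
  also have "comb (\<lambda>j. bounded k j * q ^ (j\<^sup>2 + j)) (\<lambda>j. lin * tail j) + \<dots>
      = comb (\<lambda>j. bounded k j * q ^ (j\<^sup>2 + j)) (\<lambda>j. dil q (tail j))"
    unfolding comb_add dil_tail_shift[symmetric]
    by (rule comb_cong) (simp_all add: algebra_simps)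
  also have "\<dots> = dil q (comb (\<lambda>j. bounded k j * q ^ j\<^sup>2) tail)"
    unfolding dil_comb by (simp add: power_add mult_ac)
  also have "\<dots> = lin * (fps_const (1 - q ^ Suc k) * tail (Suc k))"
    unfolding lin_tail_Suc Suc[symmetric] ..
  finally have "(lin * fps_const (1 - q ^ Suc k)) * S = (lin * fps_const (1 - q ^ Suc k)) * tail (Suc k)"
    by (simp only: mult.assoc)
  moreover have "(lin * fps_const (1 - q ^ Suc k)) $ 0 \<noteq> 0"
    using one_minus_q_power_nonzero[of k] by (simp del: power_Suc one_minus_q_power_nonzero)
  then have "lin * fps_const (1 - q ^ Suc k) \<noteq> 0"
    by (metis fps_zero_nth)
  ultimately have "S = tail (Suc k)"
    using mult_left_cancel by blast
  then show ?case
    by (simp add: S_def)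
qed

lemma Zs_eq_comb:
  "Zs u n = comb (\<lambda>j. u j * q ^ j\<^sup>2 / q ^ (j * n 0)) (\<lambda>j. Zs (bounded j) (\<lambda>s. n (Suc s)))"
  by (rule fps_ext) (subst Zs_peel, simp add: comb_def)

lemma Zs_bounded_0: "Zs (bounded 0) n = 1"
proof (rule fps_ext)
  fix b
  have "r 0 = 0 \<longrightarrow> b = 0" if "r \<in> desc_of b" for r
  proof
    assume "r 0 = 0"
    then have "r s = 0" for s
      using that by (auto simp: desc_of_def descending_seqs_def antimono_def) (metis le0 le_zero_eq)
    then show "b = 0"
      using that by (auto simp: desc_of_def total_def)
  qed
  then have "bounded 0 (r 0) = 0" if "r \<in> desc_of b" "b \<noteq> 0" for r
    using that by (force simp: bounded_def)
  then have "Zs (bounded 0) n $ b = 0" if "b \<noteq> 0"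
    using that by (simp add: Zs_def)
  then show "Zs (bounded 0) n $ b = 1 $ b"
    by (cases "b = 0") (simp_all add: bounded_def)
qed

text \<open>Both families satisfy the recursion of \<open>tail_recursion\<close>. Its terms with j >
  0 refer to lower degrees in y; the term j = 0 keeps the degree but involves only k = 0, where both
  are 1.\<close>

lemma Zs_bounded_eq_tail: "Zs (bounded k) (\<lambda>_. 0) = tail k"
proof -
  have "Zs (bounded k) (\<lambda>_. 0) $ b = tail k $ b" for b
  proof (induction b arbitrary: k rule: less_induct)
    case (less b)
    show ?case
    proof (cases b)
      case 0
      then show ?thesis by (simp add: tail_def bounded_def)
    next
      case (Suc b')
      let ?T = "\<lambda>k. Zs (bounded k) (\<lambda>_. 0)"
      have T: "?T k $ b = bounded k 0 * ?T 0 $ b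
          + (\<Sum>j\<le>b'. bounded k (Suc j) * q ^ (Suc j)\<^sup>2 * ?T (Suc j) $ (b' - j))" for k
        by (subst Zs_peel) (simp add: Suc sum.atMost_Suc_shift del: sum.atMost_Suc)
      have C: "tail k $ b = bounded k 0 * tail 0 $ b
          + (\<Sum>j\<le>b'. bounded k (Suc j) * q ^ (Suc j)\<^sup>2 * tail (Suc j) $ (b' - j))"
        by (subst tail_recursion) (simp add: comb_def Suc sum.atMost_Suc_shift del: sum.atMost_Suc)
      have "?T 0 $ b = tail 0 $ b"
        by (simp add: Zs_bounded_0 tail_def yp_def)
      moreover have "?T (Suc j) $ (b' - j) = tail (Suc j) $ (b' - j)" if "j \<le> b'" for j
        using less[of "b' - j" "Suc j"] Suc by simp
      ultimately show ?thesis
        unfolding T[of k] C by simp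
    qed
  qed
  then show ?thesis by (metis fps_ext)
qed

section \<open>Raising entries of the paired sequence by one\<close>

lemma q_power_Suc_square: "q ^ (Suc j)\<^sup>2 = q ^ j\<^sup>2 * q ^ j * q ^ Suc j"
proof -
  have "(Suc j)\<^sup>2 = j\<^sup>2 + j + Suc j"
    by (simp add: power2_eq_square)
  then show ?thesis
    by (simp only: power_add)
qed

text \<open>Induction on m, the only position where the two paired sequences differ. Peeling the
  first entry and renaming j as j + 1 contributes one factor y at each level and shifts
  \<open>u\<close>; the last level rests on the closed form \<open>tail\<close>.\<close>

lemma Zs_add_row:
  assumes "\<And>s. m \<le> s \<Longrightarrow> n s = 0"
  shows "lin * (Zs u (\<lambda>s. n s + (if s < Suc m then 1 else 0)) - Zs u (\<lambda>s. n s + (if s < m then 1 else 0)))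
    = fps_const (1 / q ^ (\<Sum>s<m. n s)) * (fps_X ^ Suc m * dil q (Zs (\<lambda>j. u (Suc j)) n))"
  using assms
proof (induction m arbitrary: n u)
  case 0
  then have n: "n = (\<lambda>_. 0)" by auto
  have "Zs u (\<lambda>s. if s < Suc 0 then 1 else 0) - Zs u (\<lambda>_. 0)
      = comb (\<lambda>j. u j * q ^ j\<^sup>2 / q ^ j) tail - comb (\<lambda>j. u j * q ^ j\<^sup>2) tail"
    unfolding Zs_eq_comb[of u] by (simp add: Zs_bounded_eq_tail)
  also have "\<dots> = comb (\<lambda>j. u j * q ^ j\<^sup>2 / q ^ j * (1 - q ^ j)) tail"
    unfolding comb_diff_coeff
    by (rule comb_cong) (simp_all add: q_nonzero right_diff_distrib)
  \<comment> \<open>The term j = 0 carries 1 - q^0 = 0; in the others 1 - q^(j+1) is what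
    \<open>lin_tail_Suc\<close> absorbs.\<close>
  also have "\<dots> = fps_X * comb (\<lambda>j. u (Suc j) * q ^ (Suc j)\<^sup>2 / q ^ Suc j)
      (\<lambda>j. fps_const (1 - q ^ Suc j) * tail (Suc j))"
    unfolding comb_const by (rule comb_Suc) simp
  finally have "lin * (Zs u (\<lambda>s. if s < Suc 0 then 1 else 0) - Zs u (\<lambda>_. 0))
      = fps_X * comb (\<lambda>j. u (Suc j) * q ^ (Suc j)\<^sup>2 / q ^ Suc j) (\<lambda>j. dil q (tail j))"
    by (simp only: mult.left_commute[of lin fps_X] mult_comb lin_tail_Suc)
  also have "\<dots> = fps_X * dil q (comb (\<lambda>j. u (Suc j) * q ^ j\<^sup>2) tail)"
    unfolding dil_comb
    by (rule arg_cong[where f = "(*) fps_X"], rule comb_cong)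
      (simp_all add: q_nonzero q_power_Suc_square del: power_Suc)
  also have "comb (\<lambda>j. u (Suc j) * q ^ j\<^sup>2) tail = Zs (\<lambda>j. u (Suc j)) n"
    unfolding n by (subst Zs_eq_comb) (simp add: Zs_bounded_eq_tail)
  finally show ?case by (simp add: n)
next
  case (Suc m)
  let ?n = "\<lambda>s. n (Suc s)"
  let ?A = "\<lambda>j. Zs (bounded j) (\<lambda>s. ?n s + (if s < Suc m then 1 else 0))"
  let ?B = "\<lambda>j. Zs (bounded j) (\<lambda>s. ?n s + (if s < m then 1 else 0))"
  let ?c = "fps_const (1 / q ^ (\<Sum>s<m. ?n s))"
  have IH: "lin * (?A j - ?B j) = ?c * (fps_X ^ Suc m * dil q (Zs (\<lambda>i. bounded j (Suc i)) ?n))" for j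
    by (rule Suc.IH) (simp add: Suc.prems)
  have IHS: "lin * (?A (Suc j) - ?B (Suc j)) = ?c * (fps_X ^ Suc m * dil q (Zs (bounded j) ?n))" for j
    unfolding IH bounded_Suc_Suc ..
  \<comment> \<open>A first entry 0 admits no positive successor, so the term j = 0 of the
    difference vanishes.\<close>
  have "Zs (\<lambda>i. bounded 0 (Suc i)) ?n = 0"
    by (rule fps_ext) (simp add: Zs_def bounded_0_Suc)
  then have IH0: "lin * (?A 0 - ?B 0) = 0"
    unfolding IH by (simp add: fps_ext)
  have "Zs u (\<lambda>s. n s + (if s < Suc (Suc m) then 1 else 0)) - Zs u (\<lambda>s. n s + (if s < Suc m then 1 else 0))
      = comb (\<lambda>j. u j * q ^ j\<^sup>2 / q ^ (j * (n 0 + 1))) (\<lambda>j. ?A j - ?B j)"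
    unfolding comb_diff[symmetric] Zs_eq_comb[of u] by simp
  then have "lin * (Zs u (\<lambda>s. n s + (if s < Suc (Suc m) then 1 else 0)) - Zs u (\<lambda>s. n s + (if s < Suc m then 1 else 0)))
      = comb (\<lambda>j. u j * q ^ j\<^sup>2 / q ^ (j * (n 0 + 1))) (\<lambda>j. lin * (?A j - ?B j))"
    by (simp only: mult_comb)
  also have "\<dots> = fps_X * comb (\<lambda>j. u (Suc j) * q ^ (Suc j)\<^sup>2 / q ^ (Suc j * (n 0 + 1)))
      (\<lambda>j. ?c * (fps_X ^ Suc m * dil q (Zs (bounded j) ?n)))"
    unfolding IHS[symmetric] by (rule comb_Suc) (simp only: IH0 mult_zero_right)
  also have "\<dots> = ?c * (fps_X ^ Suc (Suc m) *
      comb (\<lambda>j. u (Suc j) * q ^ (Suc j)\<^sup>2 / q ^ (Suc j * (n 0 + 1))) (\<lambda>j. dil q (Zs (bounded j) ?n)))"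
    unfolding mult_comb[symmetric] by (simp add: mult_ac)
  also have "comb (\<lambda>j. u (Suc j) * q ^ (Suc j)\<^sup>2 / q ^ (Suc j * (n 0 + 1))) (\<lambda>j. dil q (Zs (bounded j) ?n))
      = fps_const (1 / q ^ n 0) * dil q (Zs (\<lambda>j. u (Suc j)) n)"
    unfolding Zs_eq_comb[of _ n] dil_comb const_mult_comb
  proof (rule comb_cong)
    fix j
    \<comment> \<open>In (j + 1)^2 = j^2 + j + (j + 1) the part j + 1 cancels the raised entry, j
      becomes the dilation, and the leftover q^(-n 0) joins the constant.\<close>
    have "q ^ (Suc j * (n 0 + 1)) = q ^ (j * n 0) * q ^ n 0 * q ^ Suc j"
      by (simp add: power_add mult_ac)
    then show "u (Suc j) * q ^ (Suc j)\<^sup>2 / q ^ (Suc j * (n 0 + 1))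
        = 1 / q ^ n 0 * (u (Suc j) * q ^ j\<^sup>2 / q ^ (j * n 0) * q ^ j)"
      by (simp add: q_power_Suc_square q_nonzero mult_ac del: power_Suc mult_Suc)
  qed simp
  also have "?c * (fps_X ^ Suc (Suc m) * \<dots>)
      = (?c * fps_const (1 / q ^ n 0)) * (fps_X ^ Suc (Suc m) * dil q (Zs (\<lambda>j. u (Suc j)) n))"
    by (simp only: mult_ac)
  also have "?c * fps_const (1 / q ^ n 0) = fps_const (1 / q ^ (\<Sum>s<Suc m. n s))"
    by (simp add: sum.lessThan_Suc_shift power_add mult_ac del: sum.lessThan_Suc)
  finally show ?case .
qed

abbreviation Z1 :: "(nat \<Rightarrow> nat) \<Rightarrow> 'k fps" where
  "Z1 \<equiv> Zs (\<lambda>_. 1)"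

abbreviation thicken :: "nat \<Rightarrow> (nat \<Rightarrow> nat) \<Rightarrow> nat \<Rightarrow> nat" where
  "thicken m n \<equiv> \<lambda>s. n s + (if s < m then 1 else 0)"

section \<open>Palindromic numerators\<close>

text \<open>By Euler's identity this is the product of the 1 / (1 - q^m y), m > 0. An infinite
  product has no meaning in an abstract field, so the series stands in for it, through its
  functional equation under y -> q y.\<close>

definition eser :: "'k fps" where
  "eser = Abs_fps (\<lambda>k. q ^ k / qp k)"

lemma eser_nth_0 [simp]: "eser $ 0 = 1"
  by (simp add: eser_def)

lemma eser_nth_Suc: "eser $ Suc k * (1 - q ^ Suc k) = q * eser $ k"
  using one_minus_q_power_nonzero[of k] by (simp add: eser_def qp_Suc del: one_minus_q_power_nonzero)

lemma dil_eser: "dil q eser = lin * eser"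
proof (rule fps_ext)
  fix k
  show "dil q eser $ k = (lin * eser) $ k"
  proof (cases k)
    case (Suc j)
    have "(lin * eser) $ Suc j = eser $ Suc j - q * eser $ j"
      by (simp add: left_diff_distrib mult.assoc)
    then show ?thesis
      unfolding Suc using eser_nth_Suc[of j] by (simp add: algebra_simps)
  qed simp
qed

lemma dil_inverse_dil: "dil (1 / q) (dil q F) = F" "dil q (dil (1 / q) F) = F"
  by (rule fps_ext, simp add: q_nonzero power_divide)+

lemma eser_eq: "eser = (1 - fps_X) * dil (1 / q) eser"
proof -
  have "fps_const (1 / q) * (fps_const q * fps_X) = (fps_X :: 'k fps)"
    by (simp add: mult.assoc[symmetric] q_nonzero)
  then have "dil (1 / q) lin = 1 - fps_X"
    by (simp add: dil_diff dil_mult mult.left_commute)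
  then show ?thesis
    using arg_cong[OF dil_eser, of "dil (1 / q)"] by (simp add: dil_inverse_dil dil_mult)
qed

text \<open>For b \<le> M all nonzero entries of r lie in the raised range, so the pairing grows by
  exactly the total b.\<close>

lemma weight_thicken:
  assumes "r \<in> desc_of b" "b \<le> M"
  shows "weight (thicken M n) r = weight n r / q ^ b"
proof -
  have 0: "r s = 0" if "b \<le> s" for s
    using desc_of_eq_0[OF assms(1) that] .
  have "(\<Sum>s<b. r s * thicken M n s) = (\<Sum>s<b. r s * n s + r s)"
    by (rule sum.cong) (use assms in auto)
  also have "\<dots> = (\<Sum>s<b. r s * n s) + b"
    using total_lessThan[of b r] 0 total_desc_of[OF assms(1)] by (simp add: sum.distrib)
  finally have "(\<Sum>s<b. r s * thicken M n s) = (\<Sum>s<b. r s * n s) + b" .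
  then show ?thesis
    using weight_lessThan[of b r, OF 0] by (simp only: power_add) simp
qed

lemma Z1_thicken_nth:
  assumes "b \<le> M"
  shows "Z1 (thicken M n) $ b = dil (1 / q) (Z1 n) $ b"
proof -
  have "(\<Sum>r\<in>desc_of b. weight (thicken M n) r) = (\<Sum>r\<in>desc_of b. weight n r / q ^ b)"
    by (rule sum.cong) (use weight_thicken assms in auto)
  then show ?thesis
    by (simp add: Zs_def sum_divide_distrib[symmetric] power_divide)
qed

text \<open>Summing \<open>Zs_add_row\<close> over all k \<ge> M telescopes: the raised sequences
  approach the one raised everywhere, whose series is Z_n(y / q), and the right-hand sides form a
  geometric series, hence the factor 1 - y.\<close>

lemma Z1_thicken:
  assumes "\<And>s. M \<le> s \<Longrightarrow> n s = 0"
  shows "lin * ((1 - fps_X) * (dil (1 / q) (Z1 n) - Z1 (thicken M n)))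
    = fps_const (1 / q ^ (\<Sum>s<M. n s)) * (fps_X ^ Suc M * dil q (Z1 n))"
proof -
  define c where "c = fps_const (1 / q ^ (\<Sum>s<M. n s)) * dil q (Z1 n)"
  \<comment> \<open>\<open>U k\<close> is the defect of the claim with M replaced by k and the
    constant kept. It is the same for all k \<ge> M, and its coefficient of degree b vanishes once k
    \<ge> b.\<close>
  define U where "U k = lin * ((1 - fps_X) * (dil (1 / q) (Z1 n) - Z1 (thicken k n))) - fps_X ^ Suc k * c" for k
  have c_eq: "fps_const (1 / q ^ (\<Sum>s<k. n s)) * dil q (Z1 n) = c" if "M \<le> k" for k
  proof -
    have "(\<Sum>s<M. n s) = (\<Sum>s<k. n s)"
      by (rule sum.mono_neutral_left) (use assms that in auto)
    then show ?thesis by (simp add: c_def)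
  qed
  have step: "U (Suc k) = U k" if "M \<le> k" for k
  proof -
    have "lin * (Z1 (thicken (Suc k) n) - Z1 (thicken k n))
        = fps_const (1 / q ^ (\<Sum>s<k. n s)) * (fps_X ^ Suc k * dil q (Z1 n))"
      by (rule Zs_add_row) (use assms that in auto)
    also have "\<dots> = fps_X ^ Suc k * c"
      by (simp only: c_eq[OF that, symmetric] mult_ac)
    finally have *: "lin * (Z1 (thicken (Suc k) n) - Z1 (thicken k n)) = fps_X ^ Suc k * c" .
    have "U k - U (Suc k) = (1 - fps_X) * (lin * (Z1 (thicken (Suc k) n) - Z1 (thicken k n))
        - fps_X ^ Suc k * c)"
      unfolding U_def by (simp add: algebra_simps)
    then show ?thesis unfolding * by simp
  qed
  have const: "U (M + k) = U M" for k
    by (induction k) (use step in auto)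
  have "U M $ b = 0" for b
  proof -
    let ?k = "M + b"
    have "(A * (dil (1 / q) (Z1 n) - Z1 (thicken ?k n))) $ b = 0" for A
      unfolding fps_mult_nth by (rule sum.neutral) (use Z1_thicken_nth[of _ ?k n] in auto)
    then have "(lin * ((1 - fps_X) * (dil (1 / q) (Z1 n) - Z1 (thicken ?k n)))) $ b = 0"
      by (simp only: mult.assoc[symmetric])
    moreover have "(fps_X ^ Suc ?k * c) $ b = 0"
      by (simp add: fps_X_power_mult_nth del: power_Suc)
    ultimately have "U ?k $ b = 0"
      unfolding U_def by (simp only: fps_sub_nth diff_self)
    then show ?thesis by (simp only: const)
  qed
  then have "U M = 0" by (simp add: fps_eq_iff)
  then show ?thesis unfolding U_def c_def by (simp only: right_minus_eq) (simp only: mult_ac)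
qed

definition Ps :: "(nat \<Rightarrow> nat) \<Rightarrow> 'k fps" where
  "Ps n = Z1 n * inverse eser"

lemma Z1_eq_Ps: "Z1 n = eser * Ps n"
proof -
  have "eser * inverse eser = 1"
    by (simp add: inverse_mult_eq_1')
  then show ?thesis
    by (simp add: Ps_def mult.left_commute[of eser])
qed

text \<open>The functional equation expresses \<open>eser\<close> at y / q and at q y through
  \<open>eser\<close> itself, so the common factor (1 - q y) \<open>eser\<close> cancels from
  \<open>Z1_thicken\<close>.\<close>

lemma Ps_thicken:
  assumes "\<And>s. M \<le> s \<Longrightarrow> n s = 0"
  shows "(1 - fps_X) * Ps (thicken M n)
    = dil (1 / q) (Ps n) - fps_const (1 / q ^ (\<Sum>s<M. n s)) * (fps_X ^ Suc M * dil q (Ps n))"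
proof -
  let ?c = "fps_const (1 / q ^ (\<Sum>s<M. n s))"
  have rearrange: "(l * e) * (a - y * b) = (l * e) * (c * (x * d))"
    if "l * (e * a - y * (e * b)) = c * (x * (l * e * d))" for l e a y b c x d :: "'k fps"
    using that by (simp add: algebra_simps)
  have "lin * ((1 - fps_X) * dil (1 / q) eser * dil (1 / q) (Ps n) - (1 - fps_X) * (eser * Ps (thicken M n)))
     = ?c * (fps_X ^ Suc M * (dil q eser * dil q (Ps n)))"
    using Z1_thicken[OF assms] unfolding Z1_eq_Ps dil_mult by (simp only: right_diff_distrib mult.assoc)
  then have "(lin * eser) * (dil (1 / q) (Ps n) - (1 - fps_X) * Ps (thicken M n))
     = (lin * eser) * (?c * (fps_X ^ Suc M * dil q (Ps n)))"
    unfolding eser_eq[symmetric] dil_eser by (rule rearrange)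
  moreover have "(lin * eser) $ 0 \<noteq> 0"
    by simp
  then have "lin * eser \<noteq> 0"
    by (metis fps_zero_nth)
  ultimately have "dil (1 / q) (Ps n) - (1 - fps_X) * Ps (thicken M n)
      = ?c * (fps_X ^ Suc M * dil q (Ps n))"
    using mult_left_cancel by blast
  then show ?thesis by (simp only: algebra_simps)
qed

definition palindromic :: "nat \<Rightarrow> 'k fps \<Rightarrow> bool" where
  "palindromic N F \<longleftrightarrow> (\<forall>b>N. F $ b = 0) \<and> (\<forall>b\<le>N. F $ (N - b) = F $ b)"

text \<open>With K = N + M + 1, the coefficients of (1 - y) G are antisymmetric under i -> K - i.
  Hence they sum to zero, and their partial sums, the coefficients of G, stop at degree N + M and
  are symmetric.\<close>

lemma palindromic_thicken:
  assumes F: "palindromic N F"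
    and G: "(1 - fps_X) * G = dil (1 / q) F - fps_const (1 / q ^ N) * (fps_X ^ Suc M * dil q F)"
  shows "palindromic (N + M) G"
proof -
  define K where "K = N + Suc M"
  define a where "a i = F $ i / q ^ i" for i
  define c where "c i = ((1 - fps_X) * G) $ i" for i
  have c: "c i = a i - (if Suc M \<le> i then q ^ (i - Suc M) * F $ (i - Suc M) / q ^ N else 0)" for i
    unfolding c_def G by (simp add: a_def fps_X_power_mult_nth power_divide del: power_Suc)
  have anti: "c i = a i - a (K - i)" if "i \<le> K" for i
  proof (cases "Suc M \<le> i")
    case True
    define j where "j = i - Suc M"
    have j: "j \<le> N" "K - i = N - j"
      using True that by (auto simp: j_def K_def)
    have "q ^ N = q ^ j * q ^ (N - j)"
      using j by (simp add: power_add[symmetric])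
    then have "a (K - i) = q ^ j * F $ j / q ^ N"
      using F j by (simp add: a_def palindromic_def q_nonzero)
    then show ?thesis using True by (simp add: c j_def)
  next
    case False
    then have "N < K - i" by (simp add: K_def)
    then show ?thesis using False F by (simp add: c a_def palindromic_def)
  qed
  have zero: "c i = 0" if "K < i" for i
    using F that by (simp add: c a_def palindromic_def K_def)
  have G_nth: "G $ b = (\<Sum>i\<le>b. c i)" for b
  proof (induction b)
    case (Suc b)
    have "c (Suc b) = G $ Suc b - G $ b"
      by (simp add: c_def left_diff_distrib)
    then show ?case using Suc by simp
  qed (simp add: c_def)
  have rev: "(\<Sum>i\<le>K. a (K - i)) = (\<Sum>i\<le>K. a i)"
    by (rule sum.reindex_bij_witness[where i = "\<lambda>i. K - i" and j = "\<lambda>i. K - i"]) auto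
  have total: "(\<Sum>i\<le>K. c i) = 0"
    using rev anti by (simp add: sum_subtractf)
  have "G $ b = 0" if "N + M < b" for b
  proof -
    have "(\<Sum>i\<le>b. c i) = (\<Sum>i\<le>K. c i)"
      by (rule sum.mono_neutral_right) (use that zero in \<open>auto simp: K_def\<close>)
    then show ?thesis using total by (simp add: G_nth)
  qed
  moreover have "G $ (N + M - b) = G $ b" if b: "b \<le> N + M" for b
  proof -
    \<comment> \<open>The partial sum up to N + M - b is minus the sum of the last b + 1
      coefficients, which antisymmetry turns into the partial sum up to b.\<close>
    have "{..K} = {..N + M - b} \<union> {K - b..K}"
      using b by (auto simp: K_def)
    moreover have "{..N + M - b} \<inter> {K - b..K} = {}"
      using b by (auto simp: K_def)
    ultimately have "(\<Sum>i\<le>K. c i) = (\<Sum>i\<le>N + M - b. c i) + (\<Sum>i=K - b..K. c i)"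
      by (simp add: sum.union_disjoint)
    moreover have "(\<Sum>i=K - b..K. c i) = (\<Sum>i\<le>b. - c i)"
    proof (rule sum.reindex_bij_witness[where i = "\<lambda>i. K - i" and j = "\<lambda>i. K - i"])
      fix i assume "i \<in> {K - b..K}"
      then show "- c (K - i) = c i"
        using anti[of i] anti[of "K - i"] by simp
    qed (use b in \<open>auto simp: K_def\<close>)
    ultimately show ?thesis
      using total by (simp add: G_nth sum_negf)
  qed
  ultimately show ?thesis by (simp add: palindromic_def)
qed

text \<open>Induction on the largest entry: subtracting one from all nonzero entries is undone by
  \<open>thicken\<close>, and the total drops by the number M of these entries.\<close>

lemma palindromic_Ps:
  assumes "n \<in> descending_seqs"
  shows "palindromic (total n) (Ps n)"
  using assms
proof (induction "n 0" arbitrary: n)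
  case 0
  have n: "n = (\<lambda>_. 0)"
    using 0 by (auto simp: descending_seqs_def antimono_def fun_eq_iff) (metis le0 le_zero_eq)
  let ?P = "Ps (\<lambda>_. 0)"
  have eq: "(1 - fps_X) * ?P = dil (1 / q) ?P - fps_X * dil q ?P"
    using Ps_thicken[of 0 "\<lambda>_. 0"] by simp
  \<comment> \<open>At b = 0 the factor 1 - q^b vanishes, which forces \<open>?P\<close> to be
    constant.\<close>
  have rec: "?P $ Suc b * (1 - 1 / q ^ Suc b) = (1 - q ^ b) * ?P $ b" for b
    using arg_cong[OF eq, of "\<lambda>F. F $ Suc b"]
    by (simp add: left_diff_distrib power_divide del: power_Suc) (simp add: algebra_simps)
  have "?P $ Suc b = 0" for b
  proof (induction b)
    case 0
    then show ?case using rec[of 0] q_power_neq_1[of 1] by (auto simp: q_nonzero)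
  next
    case (Suc b)
    have "1 - 1 / q ^ Suc (Suc b) \<noteq> 0"
      using q_power_neq_1[of "Suc (Suc b)"] by (auto simp: divide_simps simp del: power_Suc)
    moreover have "?P $ Suc (Suc b) * (1 - 1 / q ^ Suc (Suc b)) = 0"
      unfolding rec Suc by simp
    ultimately show ?case by (metis mult_eq_0_iff)
  qed
  then have "?P $ b = 0" if "0 < b" for b
    using that by (metis Suc_pred)
  then show ?case
    by (simp add: n palindromic_def total_def)
next
  case (Suc k)
  define M where "M = (LEAST s. n s = 0)"
  obtain N where N: "\<And>s. N \<le> s \<Longrightarrow> n s = 0"
    using Suc.prems by (auto simp: descending_seqs_iff)
  have anti: "n t \<le> n s" if "s \<le> t" for s t
    using Suc.prems that by (auto simp: descending_seqs_def antimono_def)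
  have "n M = 0"
    unfolding M_def by (rule LeastI[of _ N]) (simp add: N)
  then have M: "n s = 0 \<longleftrightarrow> M \<le> s" for s
    using anti[of M s] Least_le[of "\<lambda>s. n s = 0" s] by (auto simp: M_def)
  define n' where "n' s = n s - 1" for s
  have n: "n = thicken M n'"
  proof
    fix s show "n s = n' s + (if s < M then 1 else 0)"
      using M[of s] by (cases "s < M") (simp_all add: n'_def)
  qed
  have 0: "n' s = 0" if "M \<le> s" for s
    using that M[of s] by (simp add: n'_def)
  have tot: "total n' = (\<Sum>s<M. n' s)"
    by (rule total_lessThan) (rule 0)
  have "n' \<in> descending_seqs"
    unfolding descending_seqs_iff antimono_def using 0 anti by (auto simp: n'_def intro: diff_le_mono)
  moreover have "k = n' 0"
    using Suc.hyps(2) by (simp add: n'_def)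
  ultimately have "palindromic (total n') (Ps n')"
    by (intro Suc.hyps(1))
  moreover have "(1 - fps_X) * Ps (thicken M n') = dil (1 / q) (Ps n')
      - fps_const (1 / q ^ (\<Sum>s<M. n' s)) * (fps_X ^ Suc M * dil q (Ps n'))"
    by (rule Ps_thicken) (rule 0)
  ultimately have "palindromic (total n' + M) (Ps (thicken M n'))"
    unfolding tot by (rule palindromic_thicken)
  moreover have "total n = total n' + M"
  proof -
    have "total n = (\<Sum>s<M. n s)"
      by (rule total_lessThan) (simp add: M)
    also have "\<dots> = (\<Sum>s<M. n' s + 1)"
      by (rule sum.cong) (auto simp: n)
    finally show ?thesis unfolding tot by (simp add: sum_Suc)
  qed
  ultimately show ?case using n by simp
qed

end

section \<open>Reflections acting on exponents\<close>

text \<open>Coefficients are extended by zero to all of \<open>\<int>\<^sup>2\<close>, so that linear maps act on the exponents.\<close>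

definition coef :: "'r::comm_ring_1 fps fps \<Rightarrow> int \<times> int \<Rightarrow> 'r" where
  "coef F v = (if 0 \<le> fst v \<and> 0 \<le> snd v then F $ nat (fst v) $ nat (snd v) else 0)"

lemma coef_of_nat [simp]: "coef F (int a, int b) = F $ a $ b"
  by (simp add: coef_def)

text \<open>The freedom in S matters because a reflection need not map the box of v to the box of
  its image.\<close>

lemma coef_mult:
  assumes "finite S" "{0..fst v} \<times> {0..snd v} \<subseteq> S"
  shows "coef (F * G) v = (\<Sum>u\<in>S. coef F u * coef G (v - u))"
proof -
  have "(\<Sum>u\<in>S. coef F u * coef G (v - u)) = (\<Sum>u\<in>{0..fst v} \<times> {0..snd v}. coef F u * coef G (v - u))"
  proof (rule sum.mono_neutral_right)
    show "\<forall>u\<in>S - {0..fst v} \<times> {0..snd v}. coef F u * coef G (v - u) = 0"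
      by (auto simp: coef_def mem_Times_iff)
  qed (use assms in auto)
  also have "\<dots> = coef (F * G) v"
  proof (cases "0 \<le> fst v \<and> 0 \<le> snd v")
    case True
    define a b where "a = nat (fst v)" and "b = nat (snd v)"
    have v: "v = (int a, int b)"
      using True by (simp add: a_def b_def prod_eq_iff)
    have "coef (F * G) v = (\<Sum>i=0..a. \<Sum>j=0..b. F $ i $ j * G $ (a - i) $ (b - j))"
      unfolding v coef_of_nat by (simp add: fps_mult_nth fps_sum_nth)
    also have "\<dots> = (\<Sum>(i, j)\<in>{0..a} \<times> {0..b}. F $ i $ j * G $ (a - i) $ (b - j))"
      by (simp add: sum.cartesian_product)
    also have "\<dots> = (\<Sum>u\<in>{0..fst v} \<times> {0..snd v}. coef F u * coef G (v - u))"
      by (rule sum.reindex_bij_witness[where i = "\<lambda>u. (nat (fst u), nat (snd u))"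
            and j = "\<lambda>(i, j). (int i, int j)"])
        (auto simp: v coef_def nat_diff_distrib)
    finally show ?thesis ..
  qed (auto simp: coef_def)
  finally show ?thesis ..
qed

text \<open>A relation rather than a map: s may move exponents out of the quadrant, so F need not
  have an image among the power series.\<close>

definition transported :: "(int \<times> int \<Rightarrow> int \<times> int) \<Rightarrow> 'r::comm_ring_1 fps fps \<Rightarrow> 'r fps fps \<Rightarrow> bool" where
  "transported s F F' \<longleftrightarrow> (\<forall>v. coef F' (s v) = coef F v)"

lemma transported_mult:
  assumes s: "\<And>v. s (s v) = v" "\<And>u v. s (u - v) = s u - s v"
    and "transported s F F'" "transported s G G'"
  shows "transported s (F * G) (F' * G')"
  unfolding transported_def
proof
  fix v
  define B where "B v = {0..fst v} \<times> {0..snd v}" for v :: "int \<times> int"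
  \<comment> \<open>S covers the box of v and its image under s covers the box of
    \<open>s v\<close>, so both coefficients become sums indexed by S.\<close>
  define S where "S = B v \<union> s ` B (s v)"
  have finB: "finite (B v)" for v by (simp add: B_def)
  have "coef (F' * G') (s v) = (\<Sum>u\<in>s ` S. coef F' u * coef G' (s v - u))"
    by (rule coef_mult) (use finB in \<open>auto simp: S_def B_def[symmetric] image_Un image_image s(1)\<close>)
  also have "\<dots> = (\<Sum>u\<in>S. coef F u * coef G (v - u))"
  proof (rule sum.reindex_bij_witness[where i = s and j = s])
    fix u
    have "coef F (s u) = coef F' u" "coef G (v - s u) = coef G' (s v - u)"
      using assms(3,4) unfolding transported_def by (metis s(1), metis s)
    then show "coef F (s u) * coef G (v - s u) = coef F' u * coef G' (s v - u)"
      by simp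
  qed (auto simp: s(1))
  also have "\<dots> = coef (F * G) v"
    by (rule coef_mult[symmetric]) (use finB in \<open>auto simp: S_def B_def[symmetric]\<close>)
  finally show "coef (F' * G') (s v) = coef (F * G) v" .
qed

lemma coef_diff: "coef (F - G) v = coef F v - coef G v"
  by (simp add: coef_def)

lemma transported_diff:
  "transported s F F' \<Longrightarrow> transported s G G' \<Longrightarrow> transported s (F - G) (F' - G')"
  by (simp add: transported_def coef_diff)

text \<open>\<^term>\<open>mser i j e\<close> is the series \<open>\<Sum>k. e k * (y\<^sub>1 ^ i * y\<^sub>2 ^ j) ^ k\<close>; the quotient below
  recovers \<open>k\<close> from the exponents.\<close>

definition mser :: "nat \<Rightarrow> nat \<Rightarrow> (nat \<Rightarrow> 'r::comm_ring_1) \<Rightarrow> 'r fps fps" where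
  "mser i j e = Abs_fps (\<lambda>a. Abs_fps (\<lambda>b. let k = (a + b) div (i + j) in
     if a = k * i \<and> b = k * j then e k else 0))"

lemma mser_nth_multiple:
  assumes "0 < i + j"
  shows "mser i j e $ (k * i) $ (k * j) = e k"
proof -
  have "(k * i + k * j) div (i + j) = k"
    using assms by (simp add: add_mult_distrib2[symmetric])
  then show ?thesis by (simp add: mser_def)
qed

lemma mser_nth_eq_0:
  assumes "\<And>k. \<not> (a = k * i \<and> b = k * j)"
  shows "mser i j e $ a $ b = 0"
  using assms by (auto simp: mser_def Let_def)

lemma transported_mser:
  assumes s: "\<And>v. s (s v) = v"
    and s_mult: "\<And>k. s (int (k * i), int (k * j)) = (int (k * i'), int (k * j'))"
    and "0 < i + j" "0 < i' + j'"
  shows "transported s (mser i j e) (mser i' j' e)"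
  unfolding transported_def
proof
  fix v
  show "coef (mser i' j' e) (s v) = coef (mser i j e) v"
  proof (cases "\<exists>k. v = (int (k * i), int (k * j))")
    case True
    then obtain k where "v = (int (k * i), int (k * j))" by blast
    then show ?thesis
      using assms(3,4) by (simp only: s_mult coef_of_nat mser_nth_multiple)
  next
    case False
    have zero: "coef (mser i j e) w = 0" if "\<nexists>k. w = (int (k * i), int (k * j))" for i j w
    proof (cases "0 \<le> fst w \<and> 0 \<le> snd w")
      case True
      then obtain a b where w: "w = (int a, int b)"
        by (metis nonneg_int_cases prod.collapse)
      then show ?thesis
        using that by (auto intro!: mser_nth_eq_0 simp del: of_nat_mult)
    qed (auto simp: coef_def)
    have "\<nexists>k. s v = (int (k * i'), int (k * j'))"
      using False by (metis s s_mult)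
    then have "coef (mser i' j' e) (s v) = 0" by (rule zero)
    moreover have "coef (mser i j e) v = 0" by (rule zero) (rule False)
    ultimately show ?thesis by simp
  qed
qed

lemma mser_0_1: "mser 0 1 e = fps_const (Abs_fps e)"
  by (rule fps_ext, rule fps_ext) (simp add: mser_def Let_def fps_const_def)

lemma mser_1_0: "mser 1 0 e = Abs_fps (\<lambda>a. fps_const (e a))"
  by (rule fps_ext, rule fps_ext) (auto simp add: mser_def Let_def fps_const_def)

lemma mser_0_1_mult_nth: "(mser 0 1 e * G) $ a $ b = (\<Sum>j=0..b. e j * G $ a $ (b - j))"
  unfolding mser_0_1 fps_mult_left_const_nth by (simp add: fps_mult_nth)

lemma mser_1_0_mult_nth: "(mser 1 0 e * H) $ a $ b = (\<Sum>i=0..a. e i * H $ (a - i) $ b)"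
  unfolding mser_1_0 fps_mult_nth[of _ H] by (simp add: fps_sum_nth)

text \<open>The simple reflections of \<open>G\<^sub>2\<close> in the coordinates of the simple roots.\<close>

definition refl1 :: "int \<times> int \<Rightarrow> int \<times> int" where
  "refl1 v = (snd v - fst v, snd v)"

definition refl2 :: "int \<times> int \<Rightarrow> int \<times> int" where
  "refl2 v = (fst v, 3 * fst v - snd v)"

lemma refl_simps [simp]:
  "refl1 (refl1 v) = v" "refl2 (refl2 v) = v"
  "refl1 (u - v) = refl1 u - refl1 v" "refl2 (u - v) = refl2 u - refl2 v"
  by (simp_all add: refl1_def refl2_def prod_eq_iff)

definition root_prod :: "(nat \<Rightarrow> 'r::comm_ring_1) \<Rightarrow> 'r fps fps" where
  "root_prod e = mser 1 0 e * mser 0 1 e * mser 1 1 e * mser 1 2 e * mser 1 3 e * mser 2 3 e"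

text \<open>The reflection swaps (0,1) with (1,1) and (1,3) with (2,3), and fixes (1,2). The factor
  of (1,0) is set apart because this root goes to its negative.\<close>

lemma root_prod_refl1:
  defines "H \<equiv> \<lambda>e. mser 0 1 e * mser 1 1 e * mser 1 2 e * mser 1 3 e * mser 2 3 e"
  shows "root_prod e = mser 1 0 e * H e" "transported refl1 (H e) (H e)"
proof -
  show "root_prod e = mser 1 0 e * H e"
    by (simp only: root_prod_def H_def mult_ac)
  have "transported refl1 (H e) (mser 1 1 e * mser 0 1 e * mser 1 2 e * mser 2 3 e * mser 1 3 e)"
    unfolding H_def
    by (intro transported_mult transported_mser) (simp_all add: refl1_def prod_eq_iff)
  then show "transported refl1 (H e) (H e)"
    by (simp only: H_def mult_ac)
qed

text \<open>The reflection swaps (1,0) with (1,3) and (1,1) with (1,2), and fixes (2,3); here (0,1)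
  goes to its negative.\<close>

lemma root_prod_refl2:
  defines "G \<equiv> \<lambda>e. mser 1 0 e * mser 1 1 e * mser 1 2 e * mser 1 3 e * mser 2 3 e"
  shows "root_prod e = mser 0 1 e * G e" "transported refl2 (G e) (G e)"
proof -
  show "root_prod e = mser 0 1 e * G e"
    by (simp only: root_prod_def G_def mult_ac)
  have "transported refl2 (G e) (mser 1 3 e * mser 1 2 e * mser 1 1 e * mser 1 0 e * mser 2 3 e)"
    unfolding G_def
    by (intro transported_mult transported_mser) (simp_all add: refl2_def prod_eq_iff)
  then show "transported refl2 (G e) (G e)"
    by (simp only: G_def mult_ac)
qed

text \<open>Once all coefficients of lower total degree vanish, \<open>e 0 = 1\<close> makes D, G
  and H agree at (a, b), and a reflection that lowers the degree shows that they vanish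
  there.\<close>

lemma fps_eq_0_by_reflections:
  assumes e: "e 0 = 1"
    and G: "D = mser 0 1 e * G" "transported refl2 G G"
    and H: "D = mser 1 0 e * H" "transported refl1 H H"
    and D: "D $ 0 $ 0 = 0"
  shows "D = 0"
proof -
  have "D $ a $ b = 0 \<and> G $ a $ b = 0 \<and> H $ a $ b = 0" for a b
  proof (induction "a + b" arbitrary: a b rule: less_induct)
    case less
    have zero: "G $ i $ j = 0" "H $ i $ j = 0" if "i + j < a + b" for i j
      using less[OF that] by auto
    have "D $ a $ b = (\<Sum>j=0..b. e j * G $ a $ (b - j))"
      unfolding G(1) mser_0_1_mult_nth ..
    also have "\<dots> = (\<Sum>j\<in>{0}. e j * G $ a $ (b - j))"
      by (rule sum.mono_neutral_right) (use zero in auto)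
    finally have DG: "D $ a $ b = G $ a $ b" using e by simp
    have "D $ a $ b = (\<Sum>i=0..a. e i * H $ (a - i) $ b)"
      unfolding H(1) mser_1_0_mult_nth ..
    also have "\<dots> = (\<Sum>i\<in>{0}. e i * H $ (a - i) $ b)"
      by (rule sum.mono_neutral_right) (use zero in auto)
    finally have DH: "D $ a $ b = H $ a $ b" using e by simp
    have coefG: "coef G (int a, int b) = coef G (int a, 3 * int a - int b)"
      using G(2) unfolding transported_def refl2_def by (metis fst_conv snd_conv)
    have coefH: "coef H (int a, int b) = coef H (int b - int a, int b)"
      using H(2) unfolding transported_def refl1_def by (metis fst_conv snd_conv)
    \<comment> \<open>In the first two cases 3 a - b < b, respectively b - a < a, so a reflection
      lowers the degree; a negative coordinate gives 0 at once. The third case has 4 a \<le> 2 b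
      \<le> 3 a, so a = b = 0.\<close>
    consider "3 * a < 2 * b" | "b < 2 * a" | "2 * b \<le> 3 * a" "2 * a \<le> b"
      by linarith
    then have "D $ a $ b = 0"
    proof cases
      case 1
      have "coef G (int a, 3 * int a - int b) = 0"
        using zero(1)[of a "nat (3 * int a - int b)"] 1 by (auto simp: coef_def)
      then show ?thesis using coefG DG by simp
    next
      case 2
      have "coef H (int b - int a, int b) = 0"
        using zero(2)[of "nat (int b - int a)" b] 2 by (auto simp: coef_def)
      then show ?thesis using coefH DH by simp
    next
      case 3
      then have "a = 0" "b = 0" by linarith+
      then show ?thesis using D by simp
    qed
    then show ?case using DG DH by simp
  qed
  then show ?thesis by (simp add: fps_eq_iff)
qed

section \<open>The identity over a field\<close>

lemma sum_lessThan_times_3: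
  fixes f :: "nat \<Rightarrow> nat"
  shows "(\<Sum>s<3 * N. f s) = (\<Sum>s<N. f (3 * s + 2) + f (3 * s + 1) + f (3 * s))"
proof (induction N)
  case (Suc N)
  have "3 * Suc N = Suc (Suc (Suc (3 * N)))" by simp
  then show ?case by (simp only: sum.lessThan_Suc Suc) simp
qed simp

text \<open>What the first sequence presents to the second: in the cross term every entry of
  \<open>r2\<close> in the block 3 s, 3 s + 1, 3 s + 2 is multiplied by \<open>r1 s\<close>.\<close>

definition triple :: "(nat \<Rightarrow> nat) \<Rightarrow> nat \<Rightarrow> nat" where
  "triple r s = r (s div 3)"

lemma triple_nth: "triple r (3 * s + 2) = r s" "triple r (3 * s + 1) = r s" "triple r (3 * s) = r s"
proof -
  have "(3 * s + 2) div 3 = s" "(3 * s + 1) div 3 = s" "(3 * s) div 3 = s"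
    by linarith+
  then show "triple r (3 * s + 2) = r s" "triple r (3 * s + 1) = r s" "triple r (3 * s) = r s"
    by (simp_all only: triple_def)
qed

definition collect3 :: "(nat \<Rightarrow> nat) \<Rightarrow> nat \<Rightarrow> nat" where
  "collect3 r s = r (3 * s + 2) + r (3 * s + 1) + r (3 * s)"

lemma triple_desc_of:
  assumes "r \<in> desc_of a"
  shows "triple r \<in> desc_of (3 * a)"
proof -
  have 0: "r s = 0" if "a \<le> s" for s
    using desc_of_eq_0[OF assms that] .
  have 1: "triple r s = 0" if "3 * a \<le> s" for s
    using 0[of "s div 3"] that by (simp add: triple_def)
  have "antimono r"
    using assms by (simp add: desc_of_def descending_seqs_def)
  then have "triple r \<in> descending_seqs"
    using 1 by (auto simp: descending_seqs_iff antimono_def triple_def div_le_mono)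
  moreover have "total (triple r) = (\<Sum>s<3 * a. triple r s)"
    by (rule total_lessThan) (rule 1)
  then have "total (triple r) = 3 * (\<Sum>s<a. r s)"
    unfolding sum_lessThan_times_3 triple_nth by (simp add: sum.distrib)
  ultimately show ?thesis
    using total_lessThan[of a r] 0 assms by (simp add: desc_of_def)
qed

lemma collect3_desc_of:
  assumes "r \<in> desc_of a"
  shows "collect3 r \<in> desc_of a"
proof -
  have 0: "r s = 0" if "a \<le> s" for s
    using desc_of_eq_0[OF assms that] .
  have 1: "collect3 r s = 0" if "a \<le> s" for s
    using 0 that by (simp add: collect3_def)
  have "antimono r"
    using assms by (simp add: desc_of_def descending_seqs_def)
  then have "collect3 r \<in> descending_seqs"
    using 1 by (auto simp: descending_seqs_iff antimono_def collect3_def intro!: add_mono)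
  moreover have "total (collect3 r) = total r"
    using total_lessThan[of a "collect3 r"] 1 total_lessThan[of "3 * a" r] 0
    by (simp add: sum_lessThan_times_3 collect3_def)
  ultimately show ?thesis
    using assms by (simp add: desc_of_def)
qed

text \<open>\<open>triple\<close> and \<open>collect3\<close> are adjoint for this pairing: grouping
  the positions of \<open>r2\<close> in blocks of three reads the cross term from either side. The
  bound a + b covers both supports.\<close>

lemma cross_sum:
  assumes "r1 \<in> desc_of a" "r2 \<in> desc_of b"
  shows "(\<Sum>s | r1 s \<noteq> 0. r1 s * collect3 r2 s) = (\<Sum>s | r2 s \<noteq> 0. r2 s * triple r1 s)"
proof -
  let ?N = "a + b"
  have "(\<Sum>s | r1 s \<noteq> 0. r1 s * collect3 r2 s) = (\<Sum>s<?N. r1 s * collect3 r2 s)"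
    by (rule sum_support_lessThan) (use desc_of_eq_0[OF assms(1)] in auto)
  also have "\<dots> = (\<Sum>s<3 * ?N. r2 s * triple r1 s)"
    unfolding sum_lessThan_times_3 triple_nth collect3_def
    by (rule sum.cong) (simp_all only: distrib_left mult.commute)
  also have "\<dots> = (\<Sum>s | r2 s \<noteq> 0. r2 s * triple r1 s)"
    by (rule sum_support_lessThan[symmetric]) (use desc_of_eq_0[OF assms(2)] in auto)
  finally show ?thesis .
qed

context q_series
begin

definition pair_weight :: "(nat \<Rightarrow> nat) \<Rightarrow> (nat \<Rightarrow> nat) \<Rightarrow> 'k" where
  "pair_weight r1 r2 = weight (\<lambda>_. 0) r2 * weight (collect3 r2) r1"

lemma pair_weight_eq:
  "pair_weight r1 r2 = q ^ (\<Sum>s | r1 s \<noteq> 0. (r1 s)\<^sup>2) * q ^ (\<Sum>s | r2 s \<noteq> 0. (r2 s)\<^sup>2)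
     / q ^ (\<Sum>s | r1 s \<noteq> 0. r1 s * collect3 r2 s)
     / ((\<Prod>s | r1 s \<noteq> 0. qp (r1 s - r1 (Suc s))) * (\<Prod>s | r2 s \<noteq> 0. qp (r2 s - r2 (Suc s))))"
  by (simp add: pair_weight_def weight_def mult_ac)

lemma pair_weight_triple:
  assumes "r1 \<in> desc_of a" "r2 \<in> desc_of b"
  shows "pair_weight r1 r2 = weight (\<lambda>_. 0) r1 * weight (triple r1) r2"
  using cross_sum[OF assms] by (simp add: pair_weight_def weight_def mult_ac)

definition pair_series :: "'k fps fps" where
  "pair_series = Abs_fps (\<lambda>a. Abs_fps (\<lambda>b. \<Sum>r1\<in>desc_of a. \<Sum>r2\<in>desc_of b. pair_weight r1 r2))"

lemma palindromic_sum:
  assumes "\<And>i. i \<in> A \<Longrightarrow> palindromic N (F i)"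
  shows "palindromic N (\<Sum>i\<in>A. fps_const (c i) * F i)"
  using assms by (auto simp: palindromic_def fps_sum_nth intro!: sum.neutral sum.cong)

text \<open>For fixed \<open>r1\<close> of total a, the sum over \<open>r2\<close> is
  \<open>eser\<close> times a palindromic polynomial of degree \<open>total (triple r1)\<close> = 3
  a. The symmetry b -> 3 a - b for every a is invariance under \<open>refl2\<close>.\<close>

lemma pair_series_refl2:
  obtains G where "pair_series = mser 0 1 (\<lambda>k. q ^ k / qp k) * G" "transported refl2 G G"
proof
  define g where "g a = (\<Sum>r\<in>desc_of a. fps_const (weight (\<lambda>_. 0) r) * Ps (triple r))" for a
  have "pair_series $ a = eser * g a" for a
  proof -
    have "pair_series $ a $ b = (\<Sum>r\<in>desc_of a. fps_const (weight (\<lambda>_. 0) r) * Z1 (triple r)) $ b" for b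
    proof -
      have "(\<Sum>r1\<in>desc_of a. \<Sum>r2\<in>desc_of b. pair_weight r1 r2)
          = (\<Sum>r1\<in>desc_of a. \<Sum>r2\<in>desc_of b. weight (\<lambda>_. 0) r1 * weight (triple r1) r2)"
        by (intro sum.cong refl pair_weight_triple)
      then show ?thesis
        by (simp add: pair_series_def fps_sum_nth Zs_def sum_distrib_left)
    qed
    then have "pair_series $ a = (\<Sum>r\<in>desc_of a. fps_const (weight (\<lambda>_. 0) r) * Z1 (triple r))"
      by (rule fps_ext)
    then show ?thesis
      by (simp add: g_def Z1_eq_Ps sum_distrib_left mult.left_commute)
  qed
  then show "pair_series = mser 0 1 (\<lambda>k. q ^ k / qp k) * Abs_fps g"
    unfolding mser_0_1 eser_def[symmetric] by (intro fps_ext) simp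
  have pal: "palindromic (3 * a) (g a)" for a
    unfolding g_def
  proof (rule palindromic_sum)
    fix r assume "r \<in> desc_of a"
    then show "palindromic (3 * a) (Ps (triple r))"
      using palindromic_Ps[of "triple r"] triple_desc_of[of r a] by (simp add: desc_of_def)
  qed
  show "transported refl2 (Abs_fps g) (Abs_fps g)"
    unfolding transported_def
  proof
    fix v :: "int \<times> int"
    obtain x y where v: "v = (x, y)" by fastforce
    show "coef (Abs_fps g) (refl2 v) = coef (Abs_fps g) v"
    proof (cases "0 \<le> x \<and> 0 \<le> y \<and> y \<le> 3 * x")
      case True
      then obtain a b where xy: "x = int a" "y = int b"
        by (meson zero_le_imp_eq_int)
      with True have ab: "x = int a" "y = int b" "b \<le> 3 * a"
        by simp_all
      have "coef (Abs_fps g) (refl2 v) = g a $ (3 * a - b)"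
        using ab by (simp add: coef_def v refl2_def nat_diff_distrib nat_mult_distrib)
      also have "\<dots> = g a $ b"
        using pal[of a] ab by (simp add: palindromic_def)
      finally show ?thesis by (simp add: v ab)
    next
      case False
      \<comment> \<open>Outside the strip 0 \<le> y \<le> 3 x both coefficients vanish, by sign or
        by the degree bound.\<close>
      then show ?thesis
        using pal[of "nat x"] by (auto simp: coef_def v refl2_def palindromic_def)
    qed
  qed
qed

text \<open>The roles are exchanged: \<open>collect3\<close> keeps the total b, which gives the
  symmetry a -> b - a. H is assembled by transposing indices, since y1 is the outer
  variable.\<close>

lemma pair_series_refl1:
  obtains H where "pair_series = mser 1 0 (\<lambda>k. q ^ k / qp k) * H" "transported refl1 H H"
proof
  define h where "h b = (\<Sum>r\<in>desc_of b. fps_const (weight (\<lambda>_. 0) r) * Ps (collect3 r))" for b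
  define H where "H = Abs_fps (\<lambda>a. Abs_fps (\<lambda>b. h b $ a))"
  have "pair_series $ a $ b = (eser * h b) $ a" for a b
  proof -
    have "pair_series $ a $ b = (\<Sum>r\<in>desc_of b. fps_const (weight (\<lambda>_. 0) r) * Z1 (collect3 r)) $ a"
      by (simp add: pair_series_def fps_sum_nth Zs_def sum_distrib_left pair_weight_def
          sum.swap[of _ "desc_of a" "desc_of b"])
    then show ?thesis
      by (simp add: h_def Z1_eq_Ps sum_distrib_left mult.left_commute)
  qed
  then show "pair_series = mser 1 0 (\<lambda>k. q ^ k / qp k) * H"
    by (intro fps_ext) (simp only: mser_1_0_mult_nth, simp add: fps_mult_nth eser_def H_def)
  have pal: "palindromic b (h b)" for b
    unfolding h_def
  proof (rule palindromic_sum)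
    fix r assume "r \<in> desc_of b"
    then show "palindromic b (Ps (collect3 r))"
      using palindromic_Ps[of "collect3 r"] collect3_desc_of[of r b] by (simp add: desc_of_def)
  qed
  show "transported refl1 H H"
    unfolding transported_def
  proof
    fix v :: "int \<times> int"
    obtain x y where v: "v = (x, y)" by fastforce
    show "coef H (refl1 v) = coef H v"
    proof (cases "0 \<le> x \<and> 0 \<le> y \<and> x \<le> y")
      case True
      then obtain a b where xy: "x = int a" "y = int b"
        by (meson zero_le_imp_eq_int)
      with True have ab: "x = int a" "y = int b" "a \<le> b"
        by simp_all
      have "coef H (refl1 v) = h b $ (b - a)"
        using ab by (simp add: coef_def v refl1_def nat_diff_distrib H_def)
      also have "\<dots> = h b $ a"
        using pal[of b] ab by (simp add: palindromic_def)
      finally show ?thesis by (simp add: v ab H_def)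
    next
      case False
      then show ?thesis
        using pal[of "nat y"] by (auto simp: coef_def v refl1_def palindromic_def H_def)
    qed
  qed
qed

text \<open>Each side is a simple root factor times an invariant cofactor, for both simple roots;
  the difference inherits this.\<close>

lemma pair_series_eq_root_prod: "pair_series = root_prod (\<lambda>k. q ^ k / qp k)"
proof -
  let ?e = "\<lambda>k. q ^ k / qp k"
  obtain G where G: "pair_series = mser 0 1 ?e * G" "transported refl2 G G"
    by (rule pair_series_refl2)
  obtain H where H: "pair_series = mser 1 0 ?e * H" "transported refl1 H H"
    by (rule pair_series_refl1)
  have "pair_series - root_prod ?e = 0"
  proof (rule fps_eq_0_by_reflections)
    show "pair_series - root_prod ?e
        = mser 0 1 ?e * (G - mser 1 0 ?e * mser 1 1 ?e * mser 1 2 ?e * mser 1 3 ?e * mser 2 3 ?e)"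
      unfolding G(1) root_prod_refl2(1) by (simp only: right_diff_distrib)
    show "pair_series - root_prod ?e
        = mser 1 0 ?e * (H - mser 0 1 ?e * mser 1 1 ?e * mser 1 2 ?e * mser 1 3 ?e * mser 2 3 ?e)"
      unfolding H(1) root_prod_refl1(1) by (simp only: right_diff_distrib)
    have "mser i j ?e $ 0 $ 0 = 1" for i j
      by (simp add: mser_def)
    moreover have "pair_series $ 0 $ 0 = 1"
      by (simp add: pair_series_def desc_of_0 pair_weight_def)
    ultimately show "(pair_series - root_prod ?e) $ 0 $ 0 = 0"
      by (simp add: root_prod_def)
  qed (use G(2) H(2) root_prod_refl1(2)[of ?e] root_prod_refl2(2)[of ?e] in \<open>auto intro: transported_diff\<close>)
  then show ?thesis by simp
qed

end

section \<open>Transfer to power series in \<open>q\<close>\<close>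

lemma fps_to_fls_sum: "fps_to_fls (sum f A) = (\<Sum>i\<in>A. fps_to_fls (f i))"
  by (induction A rule: infinite_finite_induct) simp_all

lemma fps_to_fls_prod: "fps_to_fls (prod f A) = (\<Prod>i\<in>A. fps_to_fls (f i :: 'a::comm_ring_1 fps))"
  by (induction A rule: infinite_finite_induct) (simp_all add: fls_times_fps_to_fls)

lemma fps_to_fls_inverse:
  fixes f :: "'a::field fps"
  assumes "f $ 0 \<noteq> 0"
  shows "fps_to_fls (inverse f) = inverse (fps_to_fls f)"
proof -
  have "fps_to_fls (inverse f) * fps_to_fls f = 1"
    unfolding fls_times_fps_to_fls[symmetric] using assms by (simp add: inverse_mult_eq_1)
  then have "fps_to_fls f * fps_to_fls (inverse f) = 1"
    by (simp only: mult.commute)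
  then show ?thesis
    by (rule inverse_unique[symmetric])
qed

interpretation fls: q_series "fls_X :: 'a::field fls"
proof
  fix n :: nat assume "0 < n"
  then have "fls_nth (fls_X ^ n :: 'a fls) 0 \<noteq> fls_nth 1 0"
    by simp
  then show "(fls_X ^ n :: 'a fls) \<noteq> 1"
    by metis
qed simp

lemma qfact_nth_0: "qfact n $ 0 = (1 :: 'a::field)"
  unfolding qfact_def by (induction n) simp_all

lemma fps_to_fls_qfact: "fps_to_fls (qfact n) = fls.qp n"
  by (simp add: qfact_def fls.qp_def fps_to_fls_prod fps_to_fls_power)

lemma fps_to_fls_q_denominator:
  "fps_to_fls (q_denominator r) = (\<Prod>s | r s \<noteq> 0. fls.qp (r s - r (Suc s)))"
  by (simp add: q_denominator_def fps_to_fls_prod fps_to_fls_qfact)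

definition euler_coeff :: "nat \<Rightarrow> 'a::field fps" where
  "euler_coeff k = fps_X ^ k * inverse (qfact k)"

lemma fps_to_fls_euler_coeff: "fps_to_fls (euler_coeff k) = fls_X ^ k / fls.qp k"
  by (simp add: euler_coeff_def fls_times_fps_to_fls fps_to_fls_inverse qfact_nth_0
      fps_to_fls_power fps_to_fls_qfact divide_inverse)

lemma euler_coeff_0 [simp]: "euler_coeff 0 = 1"
  by (simp add: euler_coeff_def qfact_def)

lemma euler_coeff_Suc:
  "euler_coeff (Suc k) * (1 - fps_X ^ Suc k) = fps_X * (euler_coeff k :: 'a::field fps)"
proof -
  let ?D = "1 - fps_X ^ Suc k :: 'a fps"
  have "?D $ 0 \<noteq> 0"
    by simp
  then have D: "inverse ?D * ?D = 1"
    by (rule inverse_mult_eq_1)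
  have "inverse (qfact (Suc k)) = inverse (qfact k) * inverse ?D"
    by (simp add: qfact_def Formal_Power_Series.fps_inverse_mult del: power_Suc)
  then have "euler_coeff (Suc k) * ?D = fps_X ^ Suc k * (inverse (qfact k) * (inverse ?D * ?D))"
    by (simp only: euler_coeff_def mult.assoc)
  also have "\<dots> = fps_X * euler_coeff k"
    unfolding D by (simp add: euler_coeff_def mult.assoc)
  finally show ?thesis .
qed

definition lift :: "'a::field fps fps fps \<Rightarrow> 'a fls fps fps" where
  "lift F = Abs_fps (\<lambda>a. Abs_fps (\<lambda>b. fps_to_fls (F $ a $ b)))"

lemma lift_nth [simp]: "lift F $ a $ b = fps_to_fls (F $ a $ b)"
  by (simp add: lift_def)

lemma lift_mult: "lift (F * G) = lift F * lift G"
  by (intro fps_ext) (simp add: fps_mult_nth fps_sum_nth fps_to_fls_sum fls_times_fps_to_fls)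

lemma lift_mser: "lift (mser i j e) = mser i j (\<lambda>k. fps_to_fls (e k))"
  by (intro fps_ext) (simp add: mser_def Let_def)

lemma lift_root_prod: "lift (root_prod e) = root_prod (\<lambda>k. fps_to_fls (e k))"
  by (simp add: root_prod_def lift_mult lift_mser)

abbreviation sum_coeff :: "(nat \<Rightarrow> nat) \<Rightarrow> (nat \<Rightarrow> nat) \<Rightarrow> 'a::field fps" where
  "sum_coeff r1 r2 \<equiv> fps_X ^ nat (q_exponent r1 r2) / (q_denominator r1 * q_denominator r2)"

lemma fps_to_fls_sum_coeff:
  assumes "r1 \<in> descending_seqs" "r2 \<in> descending_seqs"
  shows "fps_to_fls (sum_coeff r1 r2) = fls.pair_weight r1 r2"
proof -
  define A1 A2 C where "A1 = (\<Sum>s | r1 s \<noteq> 0. (r1 s)\<^sup>2)" and "A2 = (\<Sum>s | r2 s \<noteq> 0. (r2 s)\<^sup>2)"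
    and "C = (\<Sum>s | r1 s \<noteq> 0. r1 s * collect3 r2 s)"
  have "q_exponent r1 r2 = int A1 + int A2 - int C"
    by (simp add: q_exponent_def A1_def A2_def C_def collect3_def)
  \<comment> \<open>Nonnegativity makes \<open>nat\<close> exact; the cross term moves to the other
    side to avoid truncated subtraction.\<close>
  then have "A1 + A2 = nat (q_exponent r1 r2) + C"
    using q_exponent_nonneg[OF assms] by linarith
  then have eq: "fls_X ^ A1 * fls_X ^ A2 = fls_X ^ nat (q_exponent r1 r2) * (fls_X ^ C :: 'a fls)"
    by (simp only: power_add[symmetric])
  have "(fls_X ^ C :: 'a fls) \<noteq> 0"
    by simp
  then have pow: "fls_X ^ nat (q_exponent r1 r2) = fls_X ^ A1 * fls_X ^ A2 / (fls_X ^ C :: 'a fls)"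
    unfolding eq by (rule nonzero_mult_div_cancel_right[symmetric])
  have "q_denominator r1 $ 0 * q_denominator r2 $ 0 \<noteq> (0 :: 'a)"
    by (simp add: q_denominator_nonzero)
  then have "fps_to_fls (sum_coeff r1 r2) = fls_X ^ nat (q_exponent r1 r2)
      / (fps_to_fls (q_denominator r1) * fps_to_fls (q_denominator r2) :: 'a fls)"
    by (simp add: fps_divide_unit fls_times_fps_to_fls fps_to_fls_inverse fps_to_fls_power divide_inverse)
  then show ?thesis
    unfolding pow fps_to_fls_q_denominator fls.pair_weight_eq A1_def A2_def C_def .
qed

text \<open>The identity holds over Laurent series, where q is invertible, and returns to power
  series because \<open>fps_to_fls\<close> is injective.\<close>

lemma root_prod_nth:
  "root_prod euler_coeff $ a $ b = (\<Sum>r1\<in>desc_of a. \<Sum>r2\<in>desc_of b. sum_coeff r1 r2)"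
proof -
  have "fps_to_fls (root_prod euler_coeff $ a $ b :: 'a fps) = fls.pair_series $ a $ b"
    unfolding lift_nth[symmetric] lift_root_prod fps_to_fls_euler_coeff fls.pair_series_eq_root_prod ..
  also have "\<dots> = (\<Sum>r1\<in>desc_of a. \<Sum>r2\<in>desc_of b. fps_to_fls (sum_coeff r1 r2))"
    by (simp add: fls.pair_series_def) (intro sum.cong refl fps_to_fls_sum_coeff[symmetric];
        simp add: desc_of_def)
  finally show ?thesis
    unfolding fps_to_fls_sum[symmetric] by simp
qed

section \<open>Convergence of the sum\<close>

lemma const_mult_X_power_nth: "(fps_const c * fps_X ^ m) $ n = (if n = m then c else 0)"
  by (auto simp: fps_X_power_mult_right_nth)

lemma sum_term_nth:
  "sum_term r1 r2 $ a $ b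
    = (if total r1 = a \<and> total r2 = b then sum_coeff r1 r2 else 0 :: 'a::field fps)"
proof -
  have eq: "sum_term r1 r2
      = fps_const (fps_const (sum_coeff r1 r2 :: 'a fps) * fps_X ^ total r2) * fps_X ^ total r1"
    by (simp only: sum_term_def qconst_def Y1_def Y2_def fps_const_power fps_const_mult[symmetric] mult_ac)
  show ?thesis
    unfolding eq const_mult_X_power_nth by (auto simp: const_mult_X_power_nth)
qed

text \<open>Only the finitely many pairs with totals a and b contribute to y1^a y2^b, so each
  coefficient sum is finite.\<close>

lemma has_formal_sum_root_prod:
  "has_formal_sum (\<lambda>(r1, r2). sum_term r1 r2) (descending_seqs \<times> descending_seqs)
     (root_prod euler_coeff :: 'a::field fps fps fps)"
  unfolding has_formal_sum_def
proof (intro allI)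
  fix a b
  let ?S = "root_prod euler_coeff $ a $ b :: 'a fps"
  let ?g = "\<lambda>i. (case i of (r1, r2) \<Rightarrow> sum_term r1 r2) $ a $ b :: 'a fps"
  have "((\<lambda>(r1, r2). sum_coeff r1 r2) has_sum ?S) (desc_of a \<times> desc_of b)"
    by (rule has_sum_finiteI) (simp_all add: finite_desc_of root_prod_nth sum.cartesian_product)
  moreover have "((\<lambda>(r1, r2). sum_coeff r1 r2) has_sum ?S) (desc_of a \<times> desc_of b)
      \<longleftrightarrow> (?g has_sum ?S) (descending_seqs \<times> descending_seqs)"
    by (rule has_sum_cong_neutral) (auto simp: desc_of_def sum_term_nth split: if_splits)
  ultimately show "(?g has_sum ?S) (descending_seqs \<times> descending_seqs)"
    by blast
qed

section \<open>Convergence of the product\<close>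

lemma monomial_mult_nth:
  fixes G :: "'a::field fps fps fps"
  shows "(Q ^ c * Y1 ^ i * Y2 ^ j * G) $ a $ b
    = (if i \<le> a \<and> j \<le> b then fps_X ^ c * G $ (a - i) $ (b - j) else 0)"
proof -
  have "Q ^ c = (fps_const (fps_const (fps_X ^ c)) :: 'a fps fps fps)"
    "Y1 ^ i = (fps_X ^ i :: 'a fps fps fps)" "Y2 ^ j = (fps_const (fps_X ^ j) :: 'a fps fps fps)"
    by (simp_all add: qconst_def Y1_def Y2_def fps_const_power)
  then have eq: "Q ^ c * Y1 ^ i * Y2 ^ j * G
      = fps_const (fps_const (fps_X ^ c)) * (fps_const (fps_X ^ j) * (fps_X ^ i * G))"
    by (simp only: mult_ac)
  show ?thesis
    unfolding eq by (simp add: fps_X_power_mult_nth)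
qed

text \<open>The factor contains only the monomial of (i, j), so it acts within the ray of multiples
  of (i, j); off the ray both sides vanish.\<close>

lemma factor_mult_mser:
  assumes "0 < i + j" and g: "g 0 = f 0" "\<And>k. g (Suc k) = f (Suc k) - fps_X ^ c * f k"
  shows "(1 - Q ^ c * Y1 ^ i * Y2 ^ j) * mser i j f = (mser i j g :: 'a::field fps fps fps)"
proof (rule fps_ext, rule fps_ext)
  fix a b
  have lhs: "((1 - Q ^ c * Y1 ^ i * Y2 ^ j) * mser i j f) $ a $ b = mser i j f $ a $ b
      - (if i \<le> a \<and> j \<le> b then fps_X ^ c * mser i j f $ (a - i) $ (b - j) else 0)"
    by (simp only: left_diff_distrib mult_1 fps_sub_nth monomial_mult_nth)
  show "((1 - Q ^ c * Y1 ^ i * Y2 ^ j) * mser i j f) $ a $ b = mser i j g $ a $ b"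
  proof (cases "\<exists>k. a = k * i \<and> b = k * j")
    case True
    then obtain k where k: "a = k * i" "b = k * j" by blast
    show ?thesis
    proof (cases k)
      case 0
      then show ?thesis
        using assms(1) g(1) mser_nth_multiple[OF assms(1), of f 0] mser_nth_multiple[OF assms(1), of g 0]
        unfolding lhs by (auto simp: k)
    next
      case (Suc k')
      have "a - i = k' * i" "b - j = k' * j" "i \<le> a" "j \<le> b"
        by (simp_all add: k Suc)
      then show ?thesis
        unfolding lhs using g(2)[of k'] assms(1) by (simp only: k mser_nth_multiple) (simp only: Suc simp_thms if_True)
    qed
  next
    case False
    have "mser i j f $ (a - i) $ (b - j) = 0" if "i \<le> a" "j \<le> b"
    proof (rule mser_nth_eq_0)
      fix k
      show "\<not> (a - i = k * i \<and> b - j = k * j)"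
      proof
        assume "a - i = k * i \<and> b - j = k * j"
        then have "a = Suc k * i \<and> b = Suc k * j" using that by auto
        then show False using False by blast
      qed
    qed
    moreover have "mser i j f $ a $ b = 0" "mser i j g $ a $ b = 0"
      using False by (auto intro!: mser_nth_eq_0)
    ultimately show ?thesis unfolding lhs by simp
  qed
qed

text \<open>
  \<^term>\<open>root_prod (shifted_euler M)\<close> is the infinite product without its first \<open>M\<close> factors.
\<close>

definition shifted_euler :: "nat \<Rightarrow> nat \<Rightarrow> 'a::field fps" where
  "shifted_euler M k = fps_X ^ (M * k) * euler_coeff k"

text \<open>By Euler's recursion \<open>euler_coeff_Suc\<close>, multiplying by the first remaining
  factor removes it from the product.\<close>

lemma factor_mult_shifted_euler:
  assumes "0 < i + j"
  shows "(1 - Q ^ Suc M * Y1 ^ i * Y2 ^ j) * mser i j (shifted_euler M)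
    = (mser i j (shifted_euler (Suc M)) :: 'a::field fps fps fps)"
proof (rule factor_mult_mser[OF assms])
  fix k
  have "shifted_euler (Suc M) (Suc k) = fps_X ^ (M * Suc k) * (fps_X ^ Suc k * euler_coeff (Suc k))"
    by (simp add: shifted_euler_def power_add mult_ac)
  also have "fps_X ^ Suc k * euler_coeff (Suc k) = euler_coeff (Suc k) - fps_X * (euler_coeff k :: 'a fps)"
    using euler_coeff_Suc[of k, where 'a = 'a] by (simp add: algebra_simps)
  also have "fps_X ^ (M * Suc k) * \<dots> = shifted_euler M (Suc k) - fps_X ^ Suc M * shifted_euler M k"
    by (simp add: shifted_euler_def power_add right_diff_distrib mult_ac)
  finally show "shifted_euler (Suc M) (Suc k)
      = shifted_euler M (Suc k) - fps_X ^ Suc M * (shifted_euler M k :: 'a fps)" .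
qed (simp add: shifted_euler_def)

lemma product_factor_mult_root_prod:
  "product_factor (Suc M) * root_prod (shifted_euler (Suc M))
    = (root_prod (shifted_euler M) :: 'a::field fps fps fps)"
proof -
  let ?d = "\<lambda>i j. 1 - Q ^ Suc M * Y1 ^ i * Y2 ^ j :: 'a fps fps fps"
  let ?e = "\<lambda>i j. mser i j (shifted_euler M) :: 'a fps fps fps"
  have 1: "product_factor (Suc M) * (?d 1 0 * ?d 0 1 * ?d 1 1 * ?d 1 2 * ?d 1 3 * ?d 2 3) = 1"
    using product_factor_correct[of "Suc M"]
    by (simp only: power_0 power_one_right mult_1_right)
  have 2: "mser i j (shifted_euler (Suc M)) = ?d i j * ?e i j" if "0 < i + j" for i j
    using factor_mult_shifted_euler[OF that] by (rule sym)
  have "root_prod (shifted_euler (Suc M)) = (?d 1 0 * ?e 1 0) * (?d 0 1 * ?e 0 1) * (?d 1 1 * ?e 1 1)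
      * (?d 1 2 * ?e 1 2) * (?d 1 3 * ?e 1 3) * (?d 2 3 * ?e 2 3)"
    unfolding root_prod_def by (intro arg_cong2[where f = "(*)"] 2) simp_all
  also have "\<dots> = (?d 1 0 * ?d 0 1 * ?d 1 1 * ?d 1 2 * ?d 1 3 * ?d 2 3) * root_prod (shifted_euler M)"
    unfolding root_prod_def by (simp only: mult_ac)
  finally show ?thesis
    using 1 by (simp only: mult.assoc[symmetric] mult_1)
qed

lemma prod_product_factor:
  "(\<Prod>m=1..M. product_factor m) * root_prod (shifted_euler M)
    = (root_prod euler_coeff :: 'a::field fps fps fps)"
proof (induction M)
  case 0
  show ?case by (simp add: shifted_euler_def[abs_def])
next
  case (Suc M)
  then show ?case
    using product_factor_mult_root_prod[of M, where 'a = 'a] by (simp add: mult.assoc)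
qed

lemma dvd_mult_minus_1:
  fixes x y :: "'r::comm_ring_1"
  assumes "d dvd x - 1" "d dvd y - 1"
  shows "d dvd x * y - 1"
proof -
  have "x * y - 1 = x * (y - 1) + (x - 1)"
    by (simp add: algebra_simps)
  then show ?thesis using assms by (metis dvd_add dvd_mult)
qed

text \<open>The k-th term of each ray series carries q^(M k), so each of the six series is 1 modulo
  q^M, and such congruences multiply.\<close>

lemma root_prod_shifted_euler_cong:
  "qconst (fps_X ^ M) dvd root_prod (shifted_euler M) - (1 :: 'a::field fps fps fps)"
proof -
  have "qconst (fps_X ^ M) dvd mser i j (shifted_euler M) - (1 :: 'a fps fps fps)" if ij: "0 < i + j" for i j
  proof (rule dvdI)
    \<comment> \<open>\<open>?g\<close> is the series without its constant term, divided by
      q^M.\<close>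
    let ?g = "\<lambda>k. if k = 0 then 0 else fps_X ^ (M * (k - 1)) * euler_coeff k :: 'a fps"
    show "mser i j (shifted_euler M) - 1 = qconst (fps_X ^ M) * mser i j ?g"
    proof (rule fps_ext, rule fps_ext)
      fix a b
      have rhs: "(qconst (fps_X ^ M) * mser i j ?g) $ a $ b = fps_X ^ M * mser i j ?g $ a $ b"
        by (simp add: qconst_def)
      show "(mser i j (shifted_euler M) - 1) $ a $ b = (qconst (fps_X ^ M) * mser i j ?g) $ a $ b"
      proof (cases "\<exists>k. a = k * i \<and> b = k * j")
        case True
        then obtain k where k: "a = k * i" "b = k * j" by blast
        have one: "(1 :: 'a fps fps fps) $ a $ b = (if k = 0 then 1 else 0)"
          using ij by (auto simp: k)
        show ?thesis
          unfolding rhs fps_sub_nth one unfolding k mser_nth_multiple[OF ij]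
          by (cases k) (simp_all add: shifted_euler_def power_add mult.assoc)
      next
        case False
        then have "a \<noteq> 0 \<or> b \<noteq> 0" by (metis mult_0)
        then have "(1 :: 'a fps fps fps) $ a $ b = 0" by auto
        moreover have "mser i j (shifted_euler M) $ a $ b = 0" "mser i j ?g $ a $ b = 0"
          using False by (auto intro!: mser_nth_eq_0)
        ultimately show ?thesis unfolding rhs by simp
      qed
    qed
  qed
  then show ?thesis
    unfolding root_prod_def by (intro dvd_mult_minus_1) simp_all
qed

text \<open>The partial product times a series congruent to 1 modulo q^M is the limit, so the
  coefficient of q^n is final as soon as M > n.\<close>

lemma has_formal_prod_root_prod:
  "has_formal_prod product_factor (root_prod euler_coeff :: 'a::field fps fps fps)"
  unfolding has_formal_prod_def
proof (intro allI)
  fix a b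
  let ?P = "\<lambda>M. \<Prod>m=1..M. product_factor m :: 'a fps fps fps"
  show "(\<lambda>M. ?P M $ a $ b) \<longlonglongrightarrow> root_prod euler_coeff $ a $ b"
  proof (rule tendsto_fpsI)
    fix n
    have "?P M $ a $ b $ n = root_prod euler_coeff $ a $ b $ n" if "n < M" for M
    proof -
      obtain S where "root_prod (shifted_euler M) - 1 = qconst (fps_X ^ M) * (S :: 'a fps fps fps)"
        using root_prod_shifted_euler_cong[of M] by (rule dvdE)
      then have "root_prod euler_coeff = ?P M + qconst (fps_X ^ M) * (?P M * S)"
        unfolding prod_product_factor[of M, symmetric]
        by (simp add: diff_eq_eq algebra_simps)
      then have "root_prod euler_coeff $ a $ b = ?P M $ a $ b + fps_X ^ M * (?P M * S) $ a $ b"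
        by (simp add: qconst_def)
      then show ?thesis
        using that by (simp add: fps_X_power_mult_nth)
    qed
    then show "\<forall>\<^sub>F M in sequentially. ?P M $ a $ b $ n = root_prod euler_coeff $ a $ b $ n"
      by (rule eventually_mono[OF eventually_gt_at_top])
  qed
qed

theorem theorem0p2:
  shows "\<exists>F :: 'a::field fps fps fps.
           has_formal_prod product_factor F \<and>
           has_formal_sum (\<lambda>(r1, r2). sum_term r1 r2) (descending_seqs \<times> descending_seqs) F"
  using has_formal_prod_root_prod has_formal_sum_root_prod by blast

end
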